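(* Let $c>0$ and $\lambda>0$, and let $\cosh\eta_{cm}(t)$ be the random variable defined in the context from a homogeneous Poisson process of rate $\lambda$. Then the function $u(t)=E\{\cosh \eta_{cm}(t)\}$ satisfies, for $t>0$, the non-homogeneous second-order linear equation $$\frac{\mathrm{d}^2}{\mathrm{d}t^2} u -c^2 u=\frac{\lambda c^2 e^{-\frac{3}{4}\lambda t} }{\sqrt{\lambda^2+16 c^2}} \left\{e^{-\frac{t}{4} \sqrt{\lambda^2+16 c^2}} -e^{\frac{t}{4} \sqrt{\lambda^2+16 c^2}} \right\}.$$
   Context: Let $N(t)$, $t\ge 0$, be a homogeneous Poisson process of rate $\lambda>0$ with successive event times $0<S_1<S_2<\cdots$, and set $S_0=0$. Let $c>0$ (the constant hyperbolic velocity). For $t>0$ and $0\le k\le N(t)$, define $\eta_k(t)\ge 0$ by $$\cosh\eta_k(t)=\cosh c(t-S_k)\prod_{j=1}^{k}\cosh c(S_j-S_{j-1})$$ (empty product equal to $1$); this is the hyperbolic distance from the origin of the $k$-th particle in a branching system in the hyperbolic plane, where at each Poisson event the last deviated particle splits into two halves, one continuing on its geodesic and the other deviating orthogonally to the geodesic joining its position with the origin. The particle $k<N(t)$ has mass $2^{-(k+1)}$ and the particle $k=N(t)$ has mass $2^{-N(t)}$. The hyperbolic distance $\eta_{cm}(t)\ge0$ of the center of mass is defined by $$\cosh\eta_{cm}(t)=\sum_{k=0}^{N(t)-1}\frac{1}{2^{k+1}}\cosh\eta_k(t)+\frac{1}{2^{N(t)}}\cosh\eta_{N(t)}(t),$$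 where the first sum is $0$ if $N(t)=0$. *)

theory Defs
  imports "HOL-Probability.Probability"
begin

text \<open>
  A homogeneous Poisson process, given by its counting process \<open>N t\<close>, \<open>t \<ge> 0\<close>. The values of
  \<open>N t\<close> at negative times are irrelevant. The subtractions of natural numbers below are never
  truncated, because the paths are nondecreasing. That the jumps have size one almost surely is a
  consequence of the distribution of the increments and is not assumed.
\<close>

locale homogeneous_poisson_process = prob_space M
  for M :: "'a measure" and N :: "real \<Rightarrow> 'a \<Rightarrow> nat" and rate :: real +
  assumes rate_pos: "0 < rate"
    and counting_measurable: "\<And>t. 0 \<le> t \<Longrightarrow> N t \<in> measurable M (count_space UNIV)"
    and counting_zero: "\<And>\<omega>. \<omega> \<in> space M \<Longrightarrow> N 0 \<omega> = 0"
    and counting_mono: "\<And>\<omega>. \<omega> \<in> space M \<Longrightarrow> mono_on {0..} (\<lambda>t. N t \<omega>)"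
    and counting_right_continuous:
      "\<And>\<omega> t. \<omega> \<in> space M \<Longrightarrow> 0 \<le> t \<Longrightarrow> continuous (at_right t) (\<lambda>s. N s \<omega>)"
    and independent_increments:
      "\<And>(n :: nat) (t :: nat \<Rightarrow> real). 0 \<le> t 0 \<Longrightarrow> mono_on {..n} t \<Longrightarrow>
         indep_vars (\<lambda>_. count_space UNIV) (\<lambda>i \<omega>. N (t (Suc i)) \<omega> - N (t i) \<omega>) {..<n}"
    and poisson_increments:
      "\<And>s t. 0 \<le> s \<Longrightarrow> s < t \<Longrightarrow>
         distr M (count_space UNIV) (\<lambda>\<omega>. N t \<omega> - N s \<omega>) = measure_pmf (poisson_pmf (rate * (t - s)))"

text \<open>
  \<open>event_time N k \<omega>\<close> is $S_k$. For \<open>k = 0\<close> it is \<open>0\<close>; for \<open>k \<le> N t \<omega>\<close> the set is nonempty and by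
  right continuity the infimum is attained. The times with \<open>k \<ge> 1\<close> are almost surely positive and
  strictly increasing.
\<close>

definition event_time :: "(real \<Rightarrow> 'a \<Rightarrow> nat) \<Rightarrow> nat \<Rightarrow> 'a \<Rightarrow> real" where
  "event_time N k \<omega> = Inf {t. 0 \<le> t \<and> k \<le> N t \<omega>}"

text \<open>
  On \<open>{1..}\<close>, \<open>arcosh\<close> is the inverse of \<open>cosh\<close> on \<open>{0..}\<close>. Both arguments of \<open>arcosh\<close> below are
  at least \<open>1\<close>: the first is a product of values of \<open>cosh\<close>, the second an average of values of
  \<open>cosh\<close>, the masses having total \<open>1\<close>. So each distance is the nonnegative number with the given
  hyperbolic cosine.
\<close>

definition eta :: "(real \<Rightarrow> 'a \<Rightarrow> nat) \<Rightarrow> real \<Rightarrow> nat \<Rightarrow> real \<Rightarrow> 'a \<Rightarrow> real" where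
  "eta N c k t \<omega> =
     arcosh (cosh (c * (t - event_time N k \<omega>)) *
       (\<Prod>j=1..k. cosh (c * (event_time N j \<omega> - event_time N (j - 1) \<omega>))))"

definition eta_cm :: "(real \<Rightarrow> 'a \<Rightarrow> nat) \<Rightarrow> real \<Rightarrow> real \<Rightarrow> 'a \<Rightarrow> real" where
  "eta_cm N c t \<omega> =
     arcosh ((\<Sum>k<N t \<omega>. 1 / 2 ^ (k + 1) * cosh (eta N c k t \<omega>)) +
       1 / 2 ^ N t \<omega> * cosh (eta N c (N t \<omega>) t \<omega>))"

end

theory Submission
  imports Defs
begin

text \<open>
  Besides the average \<open>cosh \<eta>_cm\<close>, follow the same average with the outer \<open>cosh (c * (t - S k))\<close>
  replaced by \<open>sinh (c * (t - S k))\<close>, and the contributions of the last particle alone to both. Between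
  events these quantities solve \<open>X' = c * Y\<close>, \<open>Y' = c * X\<close>; at an event the last particle's \<open>cosh\<close>
  part is halved and its \<open>sinh\<close> part vanishes, so that the averages change by \<open>0\<close> and by minus
  half of the last \<open>sinh\<close> part. All of them are bounded by \<open>exp (c * t)\<close>. Since the increment of
  the Poisson process over \<open>[t, t + h]\<close> is independent of the past, the means satisfy a linear system
  up to errors \<open>O(h^2)\<close>, uniformly on bounded intervals, hence exactly:
  \<open>x' = c y - (\<lambda>/2) x\<close>, \<open>y' = c x - \<lambda> y\<close>, \<open>u' = c w\<close>, \<open>w' = c u - (\<lambda>/2) y\<close>. Therefore
  \<open>u'' - c^2 u = - (\<lambda> c / 2) y\<close>, and \<open>y\<close> is found by diagonalising the first two equations.
\<close>

section \<open>Hyperbolic functions and the deterministic configuration\<close>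

text \<open>Differentiation negates the index, so one boolean parameter lets each estimate below
  serve \<open>cosh\<close> and \<open>sinh\<close> together.\<close>

definition hyp :: "bool \<Rightarrow> real \<Rightarrow> real" where
  "hyp b = (if b then cosh else sinh)"

lemma hyp_add: "hyp b (x + y) = cosh y * hyp b x + sinh y * hyp (\<not> b) x"
  by (simp add: hyp_def cosh_add sinh_add algebra_simps)

lemma hyp_zero: "hyp b 0 = (if b then 1 else 0)"
  by (simp add: hyp_def)

lemma cosh_le_exp: "0 \<le> (x :: real) \<Longrightarrow> cosh x \<le> exp x"
  using cosh_plus_sinh[of x] sinh_real_nonneg_iff[of x] by linarith

lemma abs_hyp_le:
  assumes "0 \<le> x"
  shows "\<bar>hyp b x\<bar> \<le> exp x"
  using cosh_plus_sinh[of x] assms cosh_real_nonneg[of x] sinh_real_nonneg_iff[of x]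
  unfolding hyp_def by (cases b) (simp_all del: sinh_real_nonneg_iff cosh_real_nonneg)

lemma exp_minus_one_le: "exp (x :: real) - 1 \<le> x * exp x"
proof -
  have "(1 - x) * exp x \<le> exp (- x) * exp x"
    using exp_ge_add_one_self[of "- x"] by (intro mult_right_mono) auto
  then show ?thesis
    by (simp add: exp_minus algebra_simps)
qed

text \<open>The bound \<open>exp x - 1 \<le> x * exp x\<close> is used twice:
  \<open>exp x - 1 - x\<close> is at most \<open>x * (exp x - 1)\<close>, which is at most
  \<open>x\<^sup>2 * exp x\<close>.\<close>

lemma exp_second_order: "0 \<le> (x :: real) \<Longrightarrow> exp x - 1 - x \<le> x\<^sup>2 * exp x"
  using mult_left_mono[OF exp_minus_one_le, of x x]
    exp_minus_one_le[of x] by (simp add: power2_eq_square algebra_simps)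

text \<open>The addition theorem makes the difference explicit, and the coefficients
  \<open>cosh d - 1\<close> and \<open>sinh d\<close> add up to \<open>exp d - 1\<close>.\<close>

lemma hyp_Lipschitz:
  assumes "0 \<le> x" "x \<le> y"
  shows "\<bar>hyp b y - hyp b x\<bar> \<le> (y - x) * exp y"
proof -
  define d where "d = y - x"
  have d: "0 \<le> d" and y: "y = x + d"
    using assms by (simp_all add: d_def)
  have "hyp b y - hyp b x = (cosh d - 1) * hyp b x + sinh d * hyp (\<not> b) x"
    unfolding y hyp_add[of b x d] by (simp add: algebra_simps)
  also have "\<bar>\<dots>\<bar> \<le> (cosh d - 1) * exp x + sinh d * exp x"
    using d abs_hyp_le[OF assms(1)] cosh_real_ge_1[of d]
    by (intro order.trans[OF abs_triangle_ineq] add_mono)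
      (auto simp: abs_mult intro!: mult_left_mono)
  also have "\<dots> = (exp d - 1) * exp x"
    by (simp add: cosh_plus_sinh[symmetric] algebra_simps)
  also have "\<dots> \<le> (d * exp d) * exp x"
    by (intro mult_right_mono exp_minus_one_le) auto
  finally show ?thesis
    by (simp add: y exp_add mult_ac)
qed

text \<open>The flow of \<open>X' = Y\<close>, \<open>Y' = X\<close> over time \<open>d\<close> is
  compared with one Euler step. Both coefficient errors are nonnegative and add up to
  \<open>exp d - 1 - d\<close>.\<close>

lemma hyperbolic_flow_error:
  fixes d E X Y :: real
  assumes "0 \<le> d" "\<bar>X\<bar> \<le> E" "\<bar>Y\<bar> \<le> E"
  shows "\<bar>cosh d * X + sinh d * Y - X - d * Y\<bar> \<le> d\<^sup>2 * exp d * E"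
proof -
  have s: "d \<le> sinh d"
    using real_le_x_sinh[OF assms(1)] by (simp add: sinh_field_def exp_minus)
  have "cosh d * X + sinh d * Y - X - d * Y = (cosh d - 1) * X + (sinh d - d) * Y"
    by (simp add: algebra_simps)
  also have "\<bar>\<dots>\<bar> \<le> (cosh d - 1) * E + (sinh d - d) * E"
    using s assms cosh_real_ge_1[of d]
    by (intro order.trans[OF abs_triangle_ineq] add_mono)
      (auto simp: abs_mult intro!: mult_left_mono)
  also have "\<dots> = (exp d - 1 - d) * E"
    by (simp add: cosh_plus_sinh[symmetric] algebra_simps)
  also have "\<dots> \<le> d\<^sup>2 * exp d * E"
    using assms exp_second_order by (intro mult_right_mono) auto
  finally show ?thesis .
qed

text \<open>This is the hyperbolic cosine of the distance from the origin at time
  \<open>S k\<close>, where the last leg of particle \<open>k\<close> begins. The times form an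
  arbitrary sequence, which keeps probability out of the estimates.\<close>

definition chain :: "real \<Rightarrow> (nat \<Rightarrow> real) \<Rightarrow> nat \<Rightarrow> real" where
  "chain c S k = (\<Prod>j=1..k. cosh (c * (S j - S (j - 1))))"

text \<open>\<open>leaf True\<close> is the term of the last particle and \<open>cloud True\<close> the whole mass-weighted average, when
  \<open>n\<close> events have occurred at the times \<open>S 1, \<dots>, S n\<close>; index \<open>False\<close> is their \<open>sinh\<close> variant.\<close>

definition leaf :: "bool \<Rightarrow> real \<Rightarrow> (nat \<Rightarrow> real) \<Rightarrow> nat \<Rightarrow> real \<Rightarrow> real" where
  "leaf b c S n t = hyp b (c * (t - S n)) * chain c S n / 2 ^ n"

definition cloud :: "bool \<Rightarrow> real \<Rightarrow> (nat \<Rightarrow> real) \<Rightarrow> nat \<Rightarrow> real \<Rightarrow> real" where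
  "cloud b c S n t = (\<Sum>k<n. hyp b (c * (t - S k)) * chain c S k / 2 ^ (k + 1)) + leaf b c S n t"

text \<open>With weak inequalities this holds on every path, even one with simultaneous events, so
  that no null set has to be removed.\<close>

definition events_until :: "(nat \<Rightarrow> real) \<Rightarrow> nat \<Rightarrow> real \<Rightarrow> bool" where
  "events_until S n t \<longleftrightarrow> S 0 = 0 \<and> (\<forall>k<n. S k \<le> S (Suc k)) \<and> S n \<le> t"

lemma chain_0 [simp]: "chain c S 0 = 1"
  by (simp add: chain_def)

lemma chain_Suc: "chain c S (Suc k) = cosh (c * (S (Suc k) - S k)) * chain c S k"
  by (simp add: chain_def mult.commute)

lemma chain_ge_1: "1 \<le> chain c S k"
proof (induction k)
  case (Suc k)
  then show ?case
    using mult_mono[OF cosh_real_ge_1 Suc, of "c * (S (Suc k) - S k)"] by (simp add: chain_Suc)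
qed simp

lemma chain_cong: "(\<And>j. j \<le> k \<Longrightarrow> S j = S' j) \<Longrightarrow> chain c S k = chain c S' k"
  unfolding chain_def by (intro prod.cong refl) auto

lemma leaf_cong: "(\<And>j. j \<le> n \<Longrightarrow> S j = S' j) \<Longrightarrow> leaf b c S n t = leaf b c S' n t"
  unfolding leaf_def using chain_cong[of n S S' c] by simp

lemma cloud_cong:
  assumes "\<And>j. j \<le> n \<Longrightarrow> S j = S' j"
  shows "cloud b c S n t = cloud b c S' n t"
proof -
  have "chain c S k = chain c S' k" if "k < n" for k
    using that assms by (intro chain_cong) auto
  then show ?thesis
    unfolding cloud_def using assms leaf_cong[OF assms] by (auto intro!: sum.cong)
qed

lemma events_until_le:
  assumes "events_until S n t" "k \<le> n"
  shows "S k \<le> t"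
proof -
  have "S k \<le> S n"
    using assms(2,1) by (induction rule: dec_induct)
      (auto simp: events_until_def intro: order.trans)
  then show ?thesis
    using assms(1) by (simp add: events_until_def)
qed

text \<open>Each factor \<open>cosh x\<close> is at most \<open>exp x\<close>, and the exponents
  telescope to \<open>c * S k\<close> because \<open>S 0 = 0\<close>.\<close>

lemma chain_le_exp:
  assumes "0 \<le> c" "events_until S n t" "k \<le> n"
  shows "chain c S k \<le> exp (c * S k)"
  using assms(3)
proof (induction k)
  case 0
  then show ?case
    using assms by (simp add: events_until_def)
next
  case (Suc k)
  have "S k \<le> S (Suc k)"
    using Suc.prems assms(2) by (simp add: events_until_def)
  then have "cosh (c * (S (Suc k) - S k)) * chain c S k \<le>
      exp (c * (S (Suc k) - S k)) * exp (c * S k)"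
    using Suc assms(1) chain_ge_1[of c S k] by (intro mult_mono cosh_le_exp) auto
  then show ?case
    by (simp add: chain_Suc exp_add[symmetric] algebra_simps)
qed

text \<open>The leg from \<open>S k\<close> to \<open>t\<close> completes the telescoping. The bound
  depends on neither \<open>k\<close> nor \<open>n\<close>, which later makes the random variables
  bounded at each fixed time.\<close>

lemma particle_bound:
  assumes "0 \<le> c" "events_until S n t" "k \<le> n"
  shows "\<bar>hyp b (c * (t - S k)) * chain c S k\<bar> \<le> exp (c * t)"
proof -
  have "\<bar>hyp b (c * (t - S k))\<bar> * chain c S k \<le> exp (c * (t - S k)) * exp (c * S k)"
    using chain_le_exp[OF assms] chain_ge_1[of c S k] events_until_le[OF assms(2,3)] assms(1)
    by (intro mult_mono abs_hyp_le) auto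
  then show ?thesis
    using chain_ge_1[of c S k] by (simp add: abs_mult exp_add[symmetric] algebra_simps)
qed

lemma particle_increment:
  assumes "0 \<le> c" "events_until S n t" "k \<le> n" "0 \<le> h"
  shows "\<bar>hyp b (c * (t + h - S k)) * chain c S k - hyp b (c * (t - S k)) * chain c S k\<bar>
    \<le> c * h * exp (c * (t + h))"
proof -
  have "\<bar>hyp b (c * (t + h - S k)) - hyp b (c * (t - S k))\<bar> * chain c S k \<le>
      ((c * (t + h - S k) - c * (t - S k)) * exp (c * (t + h - S k))) * exp (c * S k)"
    using chain_le_exp[OF assms(1-3)] chain_ge_1[of c S k] events_until_le[OF assms(2,3)] assms(1,4)
    by (intro mult_mono hyp_Lipschitz) (auto intro!: mult_left_mono mult_nonneg_nonneg)
  also have "\<dots> = c * h * exp (c * (t + h))"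
    by (simp add: exp_add[symmetric] algebra_simps)
  finally show ?thesis
    using chain_ge_1[of c S k] by (simp add: abs_mult left_diff_distrib[symmetric])
qed

lemma masses_sum: "(\<Sum>k<n. 1 / 2 ^ (k + 1)) + 1 / 2 ^ n = (1 :: real)"
  by (induction n) (simp_all add: field_simps)

text \<open>The particles other than the last have total mass \<open>1 - 1 / 2 ^ n\<close>, which
  leaves exactly the mass of the leaf for a total bound \<open>E\<close>.\<close>

lemma weighted_sum_bound:
  fixes f :: "nat \<Rightarrow> real"
  assumes "\<And>k. k < n \<Longrightarrow> \<bar>f k\<bar> \<le> E"
  shows "\<bar>\<Sum>k<n. f k / 2 ^ (k + 1)\<bar> \<le> (1 - 1 / 2 ^ n) * E"
proof -
  have "\<bar>\<Sum>k<n. f k / 2 ^ (k + 1)\<bar> \<le> (\<Sum>k<n. E * (1 / 2 ^ (k + 1)))"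
    using assms by (intro order.trans[OF sum_abs] sum_mono) (auto simp: abs_mult divide_right_mono)
  also have "\<dots> = (\<Sum>k<n. 1 / 2 ^ (k + 1)) * E"
    by (simp only: sum_distrib_left[symmetric] mult.commute)
  also have "(\<Sum>k<n. 1 / 2 ^ (k + 1)) = 1 - 1 / (2 ^ n :: real)"
    using masses_sum[of n] by (simp only: eq_diff_eq)
  finally show ?thesis .
qed

lemma abs_leaf_le:
  assumes "0 \<le> c" "events_until S n t"
  shows "\<bar>leaf b c S n t\<bar> \<le> exp (c * t)"
proof -
  have "\<bar>leaf b c S n t\<bar> \<le> \<bar>hyp b (c * (t - S n)) * chain c S n\<bar> / 1"
    unfolding leaf_def abs_divide by (intro divide_left_mono) auto
  then show ?thesis
    using particle_bound[OF assms order.refl, of b] by simp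
qed

lemma abs_cloud_le:
  assumes "0 \<le> c" "events_until S n t"
  shows "\<bar>cloud b c S n t\<bar> \<le> exp (c * t)"
proof -
  have "\<bar>leaf b c S n t\<bar> \<le> exp (c * t) / 2 ^ n"
    using particle_bound[OF assms order.refl, of b] by (simp add: leaf_def divide_right_mono)
  moreover have "\<bar>\<Sum>k<n. hyp b (c * (t - S k)) * chain c S k / 2 ^ (k + 1)\<bar> \<le> (1 - 1 / 2 ^ n) * exp (c * t)"
    using particle_bound[OF assms] by (intro weighted_sum_bound) auto
  ultimately show ?thesis
    unfolding cloud_def by (simp add: algebra_simps)
qed

lemma leaf_add:
  "leaf b c S n (t + h) = cosh (c * h) * leaf b c S n t + sinh (c * h) * leaf (\<not> b) c S n t"
proof -
  have "c * (t + h - S n) = c * (t - S n) + c * h"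
    by (simp add: algebra_simps)
  then show ?thesis
    unfolding leaf_def by (simp only: hyp_add add_divide_distrib distrib_left distrib_right times_divide_eq_right mult.assoc)
qed

text \<open>With the event times frozen, every particle follows the same linear flow, hence so does
  every combination with fixed masses.\<close>

lemma cloud_add:
  "cloud b c S n (t + h) = cosh (c * h) * cloud b c S n t + sinh (c * h) * cloud (\<not> b) c S n t"
proof -
  have "c * (t + h - S k) = c * (t - S k) + c * h" for k
    by (simp add: algebra_simps)
  then have "hyp b (c * (t + h - S k)) * chain c S k / 2 ^ (k + 1) =
      cosh (c * h) * (hyp b (c * (t - S k)) * chain c S k / 2 ^ (k + 1)) +
      sinh (c * h) * (hyp (\<not> b) (c * (t - S k)) * chain c S k / 2 ^ (k + 1))" for k
    by (simp only: hyp_add add_divide_distrib distrib_left distrib_right times_divide_eq_right mult.assoc)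
  then show ?thesis
    unfolding cloud_def leaf_add by (simp add: sum.distrib sum_distrib_left distrib_left)
qed

section \<open>Short-time increments with no event and with one event\<close>

lemma leaf_no_event:
  assumes "0 \<le> c" "events_until S n t" "0 \<le> h"
  shows "\<bar>leaf b c S n (t + h) - leaf b c S n t - h * (c * leaf (\<not> b) c S n t)\<bar>
    \<le> c\<^sup>2 * exp (c * (t + h)) * h\<^sup>2"
  using hyperbolic_flow_error[OF _ abs_leaf_le[OF assms(1,2)] abs_leaf_le[OF assms(1,2)], of "c * h" b "\<not> b"] assms
  by (simp add: leaf_add[of b c S n t h] distrib_left[of c t h] exp_add power_mult_distrib mult_ac)

lemma cloud_no_event:
  assumes "0 \<le> c" "events_until S n t" "0 \<le> h"
  shows "\<bar>cloud b c S n (t + h) - cloud b c S n t - h * (c * cloud (\<not> b) c S n t)\<bar>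
    \<le> c\<^sup>2 * exp (c * (t + h)) * h\<^sup>2"
  using hyperbolic_flow_error[OF _ abs_cloud_le[OF assms(1,2)] abs_cloud_le[OF assms(1,2)], of "c * h" b "\<not> b"] assms
  by (simp add: cloud_add[of b c S n t h] distrib_left[of c t h] exp_add power_mult_distrib mult_ac)

text \<open>The new last particle starts its leg at \<open>S (Suc n)\<close>, so its outer factor is
  near \<open>hyp b 0\<close>; the previous outer \<open>cosh\<close> becomes a factor of the chain,
  and the mass is halved. The outer factor and this chain factor each contribute an error of order
  \<open>h\<close>, whence the constant 2.\<close>

lemma leaf_event:
  assumes c: "0 \<le> c" and ev: "events_until S n t" and s: "t \<le> S (Suc n)" "S (Suc n) \<le> t + h"
  shows "\<bar>leaf b c S (Suc n) (t + h) - hyp b 0 / 2 * leaf True c S n t\<bar> \<le> 2 * c * exp (c * (t + h)) * h"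
proof -
  define s where "s = S (Suc n)"
  define p where "p = chain c S n"
  let ?f = "hyp b (c * (t + h - s))"
  let ?v = "c * (s - S n)"
  let ?w = "c * (t - S n)"
  have le: "S n \<le> t" "t \<le> s" "s \<le> t + h"
    using ev assms by (auto simp: events_until_def s_def)
  have p: "1 \<le> p" "p \<le> exp (c * S n)"
    using chain_ge_1 chain_le_exp[OF c ev order.refl] by (auto simp: p_def)
  have h: "0 \<le> h"
    using le by simp
  \<comment> \<open>The first term moves the outer argument to 0, the second moves the event from
    \<open>s\<close> back to \<open>t\<close>; each argument changes by at most
    \<open>c * h\<close>.\<close>
  have "\<bar>?f * cosh ?v - hyp b 0 * cosh ?w\<bar> \<le> \<bar>(?f - hyp b 0) * cosh ?v\<bar> + \<bar>hyp b 0 * (cosh ?v - cosh ?w)\<bar>"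
    by (simp add: algebra_simps)
  also have "\<dots> \<le> (c * h * exp (c * (t + h - s))) * exp ?v + 1 * (c * h * exp ?v)"
  proof (unfold abs_mult, intro add_mono mult_mono)
    have "\<bar>?f - hyp b 0\<bar> \<le> (c * (t + h - s) - 0) * exp (c * (t + h - s))"
      using le c by (intro hyp_Lipschitz) auto
    also have "\<dots> \<le> c * h * exp (c * (t + h - s))"
      using le c by (intro mult_right_mono) (auto intro!: mult_left_mono)
    finally show "\<bar>?f - hyp b 0\<bar> \<le> c * h * exp (c * (t + h - s))" .
    show "\<bar>cosh ?v\<bar> \<le> exp ?v"
      using le c cosh_le_exp[of ?v] by simp
    have "\<bar>cosh ?v - cosh ?w\<bar> \<le> (?v - ?w) * exp ?v"
      using le c hyp_Lipschitz[of ?w ?v True] by (simp add: hyp_def mult_left_mono)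
    also have "\<dots> \<le> c * h * exp ?v"
      using le c by (intro mult_right_mono) (auto simp: right_diff_distrib[symmetric] intro!: mult_left_mono)
    finally show "\<bar>cosh ?v - cosh ?w\<bar> \<le> c * h * exp ?v" .
  qed (use c h in \<open>auto simp: hyp_def\<close>)
  also have "\<dots> = c * h * exp (c * (t + h - S n)) + c * h * exp (c * (s - S n))"
    by (simp add: exp_add[symmetric] algebra_simps)
  also have "\<dots> \<le> c * h * exp (c * (t + h - S n)) + c * h * exp (c * (t + h - S n))"
    using le c h by (intro add_left_mono mult_left_mono) (auto intro!: mult_left_mono)
  finally have *: "\<bar>?f * cosh ?v - hyp b 0 * cosh ?w\<bar> \<le> 2 * c * h * exp (c * (t + h - S n))"
    by simp
  have "leaf b c S (Suc n) (t + h) - hyp b 0 / 2 * leaf True c S n t =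
      (?f * cosh ?v - hyp b 0 * cosh ?w) * p / 2 ^ Suc n"
    by (simp add: leaf_def chain_Suc p_def s_def hyp_def[of True] field_simps)
  also have "\<bar>\<dots>\<bar> \<le> (2 * c * h * exp (c * (t + h - S n))) * exp (c * S n) / 1"
    unfolding abs_divide abs_mult using * p c h
    by (intro frac_le mult_mono) (auto intro: one_le_power simp flip: power_Suc)
  also have "\<dots> = 2 * c * exp (c * (t + h)) * h"
    by (simp add: exp_add[symmetric] algebra_simps)
  finally show ?thesis .
qed

text \<open>The former last particle keeps half of its mass as the term with index \<open>n\<close>
  of the sum, and the other half restarts as the new leaf. For \<open>b = True\<close> the two parts
  of the jump cancel. The constant 3 is 1 for the old particles plus 2 from
  \<open>leaf_event\<close>.\<close>

lemma cloud_event: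
  assumes c: "0 \<le> c" and ev: "events_until S n t" and s: "t \<le> S (Suc n)" "S (Suc n) \<le> t + h"
  shows "\<bar>cloud b c S (Suc n) (t + h) - (cloud b c S n t + (hyp b 0 / 2 * leaf True c S n t - leaf b c S n t / 2))\<bar>
    \<le> 3 * c * exp (c * (t + h)) * h"
proof -
  have h: "0 \<le> h"
    using s by simp
  let ?g = "\<lambda>k. hyp b (c * (t + h - S k)) * chain c S k - hyp b (c * (t - S k)) * chain c S k"
  let ?E = "c * h * exp (c * (t + h))"
  have "cloud b c S (Suc n) (t + h) - (cloud b c S n t + (hyp b 0 / 2 * leaf True c S n t - leaf b c S n t / 2)) =
      (\<Sum>k<Suc n. ?g k / 2 ^ (k + 1)) + (leaf b c S (Suc n) (t + h) - hyp b 0 / 2 * leaf True c S n t)"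
    unfolding cloud_def by (simp add: diff_divide_distrib sum_subtractf leaf_def[of b c S n])
  moreover have "\<bar>\<Sum>k<Suc n. ?g k / 2 ^ (k + 1)\<bar> \<le> (1 - 1 / 2 ^ Suc n) * ?E"
    using particle_increment[OF c ev _ h] by (intro weighted_sum_bound) (auto simp: less_Suc_eq_le)
  moreover have "(1 - 1 / 2 ^ Suc n) * ?E \<le> 1 * ?E"
    using c h by (intro mult_right_mono) auto
  moreover have "\<bar>leaf b c S (Suc n) (t + h) - hyp b 0 / 2 * leaf True c S n t\<bar> \<le> 2 * ?E"
    using leaf_event[OF assms, of b] by (simp add: mult_ac)
  ultimately show ?thesis
    by (simp add: mult_ac)
qed

section \<open>Functions with second-order increments\<close>

text \<open>Only forward increments are controlled, but uniformly on bounded intervals. An increment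
  ending at \<open>t\<close> is therefore estimated as well as one starting there, which gives
  continuity from both sides.\<close>

lemma continuous_on_from_increments:
  fixes z g :: "real \<Rightarrow> real"
  assumes incr: "\<And>T. \<exists>C. \<forall>t h. 0 \<le> t \<longrightarrow> 0 < h \<longrightarrow> t + h \<le> T \<longrightarrow> \<bar>z (t + h) - z t - h * g t\<bar> \<le> C * h\<^sup>2"
    and bdd: "\<And>T. \<exists>K. \<forall>t. 0 \<le> t \<longrightarrow> t \<le> T \<longrightarrow> \<bar>g t\<bar> \<le> K"
  shows "continuous_on {0..} z"
proof (rule continuous_on_eq_continuous_within[THEN iffD2], intro ballI)
  fix t :: real
  assume "t \<in> {0..}"
  then have t: "0 \<le> t"
    by simp
  obtain C where C: "\<And>s h. 0 \<le> s \<Longrightarrow> 0 < h \<Longrightarrow> s + h \<le> t + 1 \<Longrightarrow> \<bar>z (s + h) - z s - h * g s\<bar> \<le> C * h\<^sup>2"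
    using incr[of "t + 1"] by blast
  obtain K where K: "\<And>s. 0 \<le> s \<Longrightarrow> s \<le> t + 1 \<Longrightarrow> \<bar>g s\<bar> \<le> K"
    using bdd[of "t + 1"] by blast
  have step: "\<bar>z y - z s\<bar> \<le> \<bar>C\<bar> * (y - s)\<^sup>2 + K * (y - s)" if "0 \<le> s" "s < y" "y \<le> t + 1" for s y
  proof -
    have "\<bar>z y - z s\<bar> \<le> \<bar>z (s + (y - s)) - z s - (y - s) * g s\<bar> + \<bar>(y - s) * g s\<bar>"
      by simp
    also have "\<dots> \<le> C * (y - s)\<^sup>2 + (y - s) * K"
      using that C[of s "y - s"] K[of s] by (intro add_mono) (auto simp: abs_mult intro!: mult_left_mono)
    also have "\<dots> \<le> \<bar>C\<bar> * (y - s)\<^sup>2 + K * (y - s)"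
      by (simp add: mult_right_mono mult.commute)
    finally show ?thesis .
  qed
  have "((\<lambda>y. z y - z t) \<longlongrightarrow> 0) (at t within {0..})"
  proof (rule Lim_null_comparison)
    have "\<bar>z y - z t\<bar> \<le> \<bar>C\<bar> * (y - t)\<^sup>2 + K * \<bar>y - t\<bar>" if "0 \<le> y" "dist y t < 1" for y
      using step[of t y] step[of y t] that t
      by (cases y t rule: linorder_cases) (auto simp: dist_real_def abs_if power2_commute[of y t] split: if_splits)
    then show "\<forall>\<^sub>F y in at t within {0..}. norm (z y - z t) \<le> \<bar>C\<bar> * (y - t)\<^sup>2 + K * \<bar>y - t\<bar>"
      unfolding eventually_at by (intro exI[of _ 1]) auto
    show "((\<lambda>y. \<bar>C\<bar> * (y - t)\<^sup>2 + K * \<bar>y - t\<bar>) \<longlongrightarrow> 0) (at t within {0..})"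
      by (rule tendsto_eq_intros refl | simp)+
  qed
  then show "continuous (at t within {0..}) z"
    unfolding continuous_within by (simp add: LIM_zero_iff)
qed

text \<open>For \<open>y\<close> to the left of \<open>t\<close> the forward quotient is based at
  \<open>y\<close> and is close to \<open>g y\<close>; continuity of \<open>g\<close> then replaces
  \<open>g y\<close> by \<open>g t\<close>.\<close>

lemma has_derivative_from_increments:
  fixes z g :: "real \<Rightarrow> real"
  assumes incr: "\<And>T. \<exists>C. \<forall>t h. 0 \<le> t \<longrightarrow> 0 < h \<longrightarrow> t + h \<le> T \<longrightarrow> \<bar>z (t + h) - z t - h * g t\<bar> \<le> C * h\<^sup>2"
    and g: "continuous_on {0..} g" and t: "0 \<le> t"
  shows "(z has_real_derivative g t) (at t within {0..})"
proof -
  obtain C where C: "\<And>s h. 0 \<le> s \<Longrightarrow> 0 < h \<Longrightarrow> s + h \<le> t + 1 \<Longrightarrow> \<bar>z (s + h) - z s - h * g s\<bar> \<le> C * h\<^sup>2"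
    using incr[of "t + 1"] by blast
  have quot: "\<bar>(z y - z s) / (y - s) - g s\<bar> \<le> \<bar>C\<bar> * (y - s)" if "0 \<le> s" "s < y" "y \<le> t + 1" for s y
  proof -
    have "\<bar>(z y - z s) / (y - s) - g s\<bar> = \<bar>z (s + (y - s)) - z s - (y - s) * g s\<bar> / (y - s)"
      using that by (simp add: divide_simps abs_if split: if_splits) (auto simp: algebra_simps)
    also have "\<dots> \<le> C * (y - s)\<^sup>2 / (y - s)"
      using that C[of s "y - s"] by (intro divide_right_mono) auto
    also have "\<dots> \<le> \<bar>C\<bar> * (y - s)"
      using that by (simp add: power2_eq_square mult_right_mono)
    finally show ?thesis .
  qed
  have "((\<lambda>y. (z y - z t) / (y - t) - g t) \<longlongrightarrow> 0) (at t within {0..})"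
  proof (rule Lim_null_comparison)
    have "\<bar>(z y - z t) / (y - t) - g t\<bar> \<le> \<bar>C\<bar> * \<bar>y - t\<bar> + \<bar>g y - g t\<bar>" if y: "0 \<le> y" "y \<noteq> t" "dist y t < 1" for y
    proof (cases "t < y")
      case True
      then show ?thesis
        using quot[of t y] y t by (auto simp: dist_real_def abs_if split: if_splits)
    next
      case False
      have "(z y - z t) / (y - t) = (z t - z y) / (t - y)"
        using minus_divide_divide[of "z y - z t" "y - t"] by simp
      then show ?thesis
        using quot[of y t] y t False by (auto simp: dist_real_def)
    qed
    then show "\<forall>\<^sub>F y in at t within {0..}. norm ((z y - z t) / (y - t) - g t) \<le> \<bar>C\<bar> * \<bar>y - t\<bar> + \<bar>g y - g t\<bar>"
      unfolding eventually_at by (intro exI[of _ 1]) auto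
    have "(g \<longlongrightarrow> g t) (at t within {0..})"
      using g t by (simp add: continuous_on_def)
    then show "((\<lambda>y. \<bar>C\<bar> * \<bar>y - t\<bar> + \<bar>g y - g t\<bar>) \<longlongrightarrow> 0) (at t within {0..})"
      by - (rule tendsto_eq_intros refl | assumption | simp)+
  qed
  then show ?thesis
    unfolding has_field_derivative_iff by (simp add: LIM_zero_iff)
qed

text \<open>With the integrating factor, \<open>f t * exp (- r * t)\<close> has derivative zero on
  the convex set \<open>{0..}\<close> and so is constant.\<close>

lemma exponential_solution:
  fixes f :: "real \<Rightarrow> real"
  assumes f: "\<And>t. 0 \<le> t \<Longrightarrow> (f has_real_derivative r * f t) (at t within {0..})" and t: "0 \<le> t"
  shows "f t = f 0 * exp (r * t)"
proof -
  let ?g = "\<lambda>t. f t * exp (- r * t)"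
  have "(?g has_real_derivative 0) (at s within {0..})" if "s \<in> {0..}" for s
    using that by (auto intro!: derivative_eq_intros f)
  then obtain k where k: "\<And>s. s \<in> {0..} \<Longrightarrow> ?g s = k"
    using has_field_derivative_zero_constant[of "{0..}" ?g] by auto
  have "f t * exp (- r * t) = f 0"
    using k[of t] k[of 0] t by simp
  then show ?thesis
    by (simp add: exp_minus field_simps)
qed

section \<open>Paths and the past of the Poisson process\<close>

definition leaf_process :: "bool \<Rightarrow> real \<Rightarrow> (real \<Rightarrow> 'a \<Rightarrow> nat) \<Rightarrow> real \<Rightarrow> 'a \<Rightarrow> real" where
  "leaf_process b c N t \<omega> = leaf b c (\<lambda>k. event_time N k \<omega>) (N t \<omega>) t"

definition cloud_process :: "bool \<Rightarrow> real \<Rightarrow> (real \<Rightarrow> 'a \<Rightarrow> nat) \<Rightarrow> real \<Rightarrow> 'a \<Rightarrow> real" where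
  "cloud_process b c N t \<omega> = cloud b c (\<lambda>k. event_time N k \<omega>) (N t \<omega>) t"

lemma cosh_eta: "cosh (eta N c k t \<omega>) =
  hyp True (c * (t - event_time N k \<omega>)) * chain c (\<lambda>k. event_time N k \<omega>) k"
proof -
  have "1 \<le> cosh (c * (t - event_time N k \<omega>)) * chain c (\<lambda>k. event_time N k \<omega>) k"
    using mult_mono[OF cosh_real_ge_1[of "c * (t - event_time N k \<omega>)"] chain_ge_1[of c "\<lambda>k. event_time N k \<omega>" k]]
    by simp
  then show ?thesis
    unfolding eta_def chain_def hyp_def by simp
qed

text \<open>\<open>cosh\<close> undoes \<open>arcosh\<close> at arguments at least 1, and the
  argument here is an average of values of \<open>cosh\<close> with masses of total 1.\<close>

lemma cosh_eta_cm: "cosh (eta_cm N c t \<omega>) = cloud_process True c N t \<omega>"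
proof -
  have "1 = (\<Sum>k<N t \<omega>. 1 / 2 ^ (k + 1) * 1) + 1 / 2 ^ N t \<omega> * (1 :: real)"
    unfolding mult_1_right by (rule masses_sum[symmetric])
  also have "\<dots> \<le> (\<Sum>k<N t \<omega>. 1 / 2 ^ (k + 1) * cosh (eta N c k t \<omega>)) +
       1 / 2 ^ N t \<omega> * cosh (eta N c (N t \<omega>) t \<omega>)"
    by (intro add_mono sum_mono mult_left_mono cosh_real_ge_1) auto
  finally show ?thesis
    unfolding eta_cm_def cloud_process_def cloud_def leaf_def
    by (subst cosh_arcosh_real) (auto simp: cosh_eta)
qed

context homogeneous_poisson_process
begin

lemma counting_le: "\<omega> \<in> space M \<Longrightarrow> 0 \<le> s \<Longrightarrow> s \<le> t \<Longrightarrow> N s \<omega> \<le> N t \<omega>"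
  using counting_mono[of \<omega>] by (auto simp: mono_on_def)

lemma event_time_nonneg:
  assumes "0 \<le> t" "k \<le> N t \<omega>"
  shows "0 \<le> event_time N k \<omega>"
  unfolding event_time_def using assms by (intro cInf_greatest) auto

text \<open>A right-continuous path with values in the naturals is constant on a short interval to
  the right of \<open>s\<close>. If \<open>k\<close> is not reached at \<open>s\<close>, it is not
  reached shortly after either. The assumption \<open>k \<le> N t \<omega>\<close> makes the set
  under the infimum nonempty.\<close>

lemma event_time_le_iff:
  assumes w: "\<omega> \<in> space M" and s: "0 \<le> s" and t: "0 \<le> t" "k \<le> N t \<omega>"
  shows "event_time N k \<omega> \<le> s \<longleftrightarrow> k \<le> N s \<omega>"
proof
  assume "k \<le> N s \<omega>"
  then show "event_time N k \<omega> \<le> s"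
    unfolding event_time_def using s by (intro cInf_lower bdd_belowI[of _ 0]) auto
next
  assume le: "event_time N k \<omega> \<le> s"
  show "k \<le> N s \<omega>"
  proof (rule ccontr)
    assume "\<not> k \<le> N s \<omega>"
    have "((\<lambda>u. N u \<omega>) \<longlongrightarrow> N s \<omega>) (at_right s)"
      using counting_right_continuous[OF w s] by (simp add: continuous_within)
    then have "\<forall>\<^sub>F u in at_right s. N u \<omega> = N s \<omega>"
      by (simp add: tendsto_discrete)
    then obtain d where d: "s < d" "\<And>u. s < u \<Longrightarrow> u < d \<Longrightarrow> N u \<omega> = N s \<omega>"
      by (auto simp: eventually_at_right[OF less_add_one])
    \<comment> \<open>The midpoint is a lower bound strictly above \<open>s\<close>, so the infimum
      cannot be at most \<open>s\<close>.\<close>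
    have "(s + d) / 2 \<le> u" if "0 \<le> u" "k \<le> N u \<omega>" for u
    proof (rule ccontr)
      assume "\<not> (s + d) / 2 \<le> u"
      then have "N u \<omega> \<le> N ((s + d) / 2) \<omega>"
        using that by (intro counting_le w) auto
      also have "\<dots> = N s \<omega>"
        using d by (intro d(2)) auto
      finally show False
        using that \<open>\<not> k \<le> N s \<omega>\<close> by simp
    qed
    then have "(s + d) / 2 \<le> event_time N k \<omega>"
      unfolding event_time_def using t by (intro cInf_greatest) auto
    then show False
      using le d(1) by simp
  qed
qed

lemma events_until_path:
  assumes w: "\<omega> \<in> space M" and t: "0 \<le> t"
  shows "events_until (\<lambda>k. event_time N k \<omega>) (N t \<omega>) t"
proof -
  have "event_time N 0 \<omega> = 0"
    by (simp add: event_time_def flip: atLeast_def)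
  moreover have "event_time N k \<omega> \<le> event_time N (Suc k) \<omega>" if "k < N t \<omega>" for k
  proof -
    have k: "Suc k \<le> N t \<omega>" "0 \<le> event_time N (Suc k) \<omega>"
      using that event_time_nonneg[OF t, of "Suc k"] by auto
    \<comment> \<open>Taking \<open>s\<close> to be the event time itself shows that the infimum is
      attained.\<close>
    then have "Suc k \<le> N (event_time N (Suc k) \<omega>) \<omega>"
      using event_time_le_iff[OF w k(2) t k(1)] by simp
    then show ?thesis
      using event_time_le_iff[OF w k(2) t, of k] k by simp
  qed
  ultimately show ?thesis
    using event_time_le_iff[OF w t t order.refl] by (simp add: events_until_def)
qed

lemma abs_leaf_process_le:
  assumes "0 \<le> c" "\<omega> \<in> space M" "0 \<le> t"
  shows "\<bar>leaf_process b c N t \<omega>\<bar> \<le> exp (c * t)"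
  unfolding leaf_process_def using assms by (intro abs_leaf_le events_until_path)

lemma abs_cloud_process_le:
  assumes "0 \<le> c" "\<omega> \<in> space M" "0 \<le> t"
  shows "\<bar>cloud_process b c N t \<omega>\<bar> \<le> exp (c * t)"
  unfolding cloud_process_def using assms by (intro abs_cloud_le events_until_path)

section \<open>The natural filtration and measurability of the processes\<close>

definition past_events :: "real \<Rightarrow> 'a set set" where
  "past_events t = {{\<omega> \<in> space M. \<forall>s\<in>I. P s (N s \<omega>)} | I P. finite I \<and> I \<subseteq> {0..t}}"

definition past :: "real \<Rightarrow> 'a measure" where
  "past t = sigma (space M) (past_events t)"

lemma space_past [simp]: "space (past t) = space M"
  unfolding past_def by (intro space_measure_of) (auto simp: past_events_def)

lemma sets_past: "sets (past t) = sigma_sets (space M) (past_events t)"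
  unfolding past_def by (intro sets_measure_of) (auto simp: past_events_def)

text \<open>The finite-dimensional cylinder events generate \<open>past t\<close>; being a
  pi-system, they suffice for proving independence.\<close>

lemma Int_stable_past_events: "Int_stable (past_events t)"
proof (rule Int_stableI)
  fix A B
  assume "A \<in> past_events t" "B \<in> past_events t"
  then obtain I P J Q where A: "A = {\<omega> \<in> space M. \<forall>s\<in>I. P s (N s \<omega>)}" "finite I" "I \<subseteq> {0..t}"
    and B: "B = {\<omega> \<in> space M. \<forall>s\<in>J. Q s (N s \<omega>)}" "finite J" "J \<subseteq> {0..t}"
    by (auto simp: past_events_def)
  \<comment> \<open>\<open>P\<close> and \<open>Q\<close> constrain only the times of their own
    index sets, hence the guards on the union.\<close>
  have "A \<inter> B = {\<omega> \<in> space M. \<forall>s\<in>I \<union> J. (s \<in> I \<longrightarrow> P s (N s \<omega>)) \<and> (s \<in> J \<longrightarrow> Q s (N s \<omega>))}"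
    using A B by auto
  moreover have "finite (I \<union> J)" "I \<union> J \<subseteq> {0..t}"
    using A B by auto
  ultimately show "A \<inter> B \<in> past_events t"
    unfolding past_events_def mem_Collect_eq
    by (intro exI[of _ "I \<union> J"] exI[of _ "\<lambda>s n. (s \<in> I \<longrightarrow> P s n) \<and> (s \<in> J \<longrightarrow> Q s n)"]) simp
qed

lemma counting_measurable_past:
  assumes "0 \<le> s" "s \<le> t"
  shows "N s \<in> measurable (past t) (count_space UNIV)"
proof (rule measurableI)
  fix A :: "nat set"
  have "N s -` A \<inter> space (past t) = {\<omega> \<in> space M. \<forall>r\<in>{s}. N r \<omega> \<in> A}"
    by auto
  also have "\<dots> \<in> past_events t"
    unfolding past_events_def mem_Collect_eq using assms
    by (intro exI[of _ "{s}"] exI[of _ "\<lambda>_ n. n \<in> A"]) auto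
  finally show "N s -` A \<inter> space (past t) \<in> sets (past t)"
    unfolding sets_past by (rule sigma_sets.Basic)
qed simp

lemma past_events_subset: "past_events t \<subseteq> events"
proof
  fix A
  assume "A \<in> past_events t"
  then obtain I P where A: "A = {\<omega> \<in> space M. \<forall>s\<in>I. P s (N s \<omega>)}" "finite I" "I \<subseteq> {0..t}"
    by (auto simp: past_events_def)
  have "{\<omega> \<in> space M. P s (N s \<omega>)} \<in> events" if "s \<in> I" for s
  proof -
    have "{\<omega> \<in> space M. P s (N s \<omega>)} = N s -` Collect (P s) \<inter> space M"
      by auto
    then show ?thesis
      using counting_measurable[of s] that A(3) by (auto intro!: measurable_sets)
  qed
  then show "A \<in> events"
    unfolding A(1) using A(2) by (rule sets.sets_Collect_finite_All)
qed

lemma subalgebra_past: "subalgebra M (past t)"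
  unfolding subalgebra_def sets_past using sets.sigma_sets_subset[OF past_events_subset] by auto

text \<open>An event after \<open>t\<close> is not determined by the past, so its time is replaced
  by \<open>t\<close>. For \<open>0 \<le> s < t\<close> the sublevel set is then
  \<open>{k \<le> N s}\<close>, for \<open>s \<ge> t\<close> the whole space, and for
  \<open>s < 0\<close> empty.\<close>

lemma event_time_measurable_past:
  assumes t: "0 \<le> t"
  shows "(\<lambda>\<omega>. if k \<le> N t \<omega> then event_time N k \<omega> else t) \<in> borel_measurable (past t)"
proof (rule borel_measurableI_le)
  fix s
  note [measurable] = counting_measurable_past[of s t]
  show "{\<omega> \<in> space (past t). (if k \<le> N t \<omega> then event_time N k \<omega> else t) \<le> s} \<in> sets (past t)"
  proof (cases "t \<le> s")
    case True
    have "(if k \<le> N t \<omega> then event_time N k \<omega> else t) \<le> s" if "\<omega> \<in> space M" for \<omega>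
      using event_time_le_iff[OF that t t, of k] True by auto
    then have "{\<omega> \<in> space (past t). (if k \<le> N t \<omega> then event_time N k \<omega> else t) \<le> s} = space (past t)"
      unfolding space_past by blast
    then show ?thesis
      by (metis sets.top)
  next
    case False
    show ?thesis
    proof (cases "0 \<le> s")
      case True
      have "(if k \<le> N t \<omega> then event_time N k \<omega> else t) \<le> s \<longleftrightarrow> k \<le> N s \<omega>" if "\<omega> \<in> space M" for \<omega>
        using event_time_le_iff[OF that True t, of k] counting_le[OF that True, of t] \<open>\<not> t \<le> s\<close> by auto
      then have "{\<omega> \<in> space (past t). (if k \<le> N t \<omega> then event_time N k \<omega> else t) \<le> s} =
          N s -` {k..} \<inter> space (past t)"
        unfolding space_past vimage_def atLeast_def by blast
      moreover have "N s -` {k..} \<inter> space (past t) \<in> sets (past t)"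
        using True False by (intro measurable_sets[OF counting_measurable_past]) auto
      ultimately show ?thesis
        by (simp only:)
    next
      case False
      then have "{\<omega> \<in> space (past t). (if k \<le> N t \<omega> then event_time N k \<omega> else t) \<le> s} = {}"
        using event_time_nonneg[OF t, of k] t by (force split: if_splits)
      then show ?thesis
        by (metis sets.empty_sets)
    qed
  qed
qed

text \<open>Both processes use only event times with index at most \<open>N t\<close>, where the
  truncated times agree with the true ones. Measurability is checked for a fixed number of events
  and then composed over the countably many values of \<open>N t\<close>.\<close>

lemma
  assumes t: "0 \<le> t"
  shows leaf_process_measurable_past: "leaf_process b c N t \<in> borel_measurable (past t)"
    and cloud_process_measurable_past: "cloud_process b c N t \<in> borel_measurable (past t)"
proof -
  let ?S = "\<lambda>\<omega> k. if k \<le> N t \<omega> then event_time N k \<omega> else t"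
  note [measurable] = event_time_measurable_past[OF t] counting_measurable_past[OF t order.refl]
  have hyp_m: "hyp b \<in> borel_measurable borel" for b
    by (cases b) (auto simp: hyp_def intro!: borel_measurable_continuous_onI continuous_intros)
  have [measurable]: "(\<lambda>\<omega>. hyp b (f \<omega>)) \<in> borel_measurable (past t)"
    if "f \<in> borel_measurable (past t)" for b and f :: "'a \<Rightarrow> real"
    using measurable_compose[OF that hyp_m] by simp
  have [measurable]: "(\<lambda>\<omega>. chain c (?S \<omega>) k) \<in> borel_measurable (past t)" for k
  proof -
    have cosh_hyp: "cosh = hyp True"
      by (simp add: hyp_def)
    show ?thesis
      unfolding chain_def cosh_hyp by measurable
  qed
  have [measurable]: "(\<lambda>\<omega>. leaf b c (?S \<omega>) n t) \<in> borel_measurable (past t)" for n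
    unfolding leaf_def by measurable
  have [measurable]: "(\<lambda>\<omega>. cloud b c (?S \<omega>) n t) \<in> borel_measurable (past t)" for n
    unfolding cloud_def by measurable
  have "(\<lambda>\<omega>. leaf b c (?S \<omega>) (N t \<omega>) t) \<in> borel_measurable (past t)"
    by (rule measurable_compose_countable) measurable
  moreover have "leaf_process b c N t = (\<lambda>\<omega>. leaf b c (?S \<omega>) (N t \<omega>) t)"
    unfolding leaf_process_def by (intro ext leaf_cong) simp
  ultimately show "leaf_process b c N t \<in> borel_measurable (past t)"
    by simp
  have "(\<lambda>\<omega>. cloud b c (?S \<omega>) (N t \<omega>) t) \<in> borel_measurable (past t)"
    by (rule measurable_compose_countable) measurable
  moreover have "cloud_process b c N t = (\<lambda>\<omega>. cloud b c (?S \<omega>) (N t \<omega>) t)"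
    unfolding cloud_process_def by (intro ext cloud_cong) simp
  ultimately show "cloud_process b c N t \<in> borel_measurable (past t)"
    by simp
qed

section \<open>Independence of the increments from the past\<close>

text \<open>On a finite grid containing all times of \<open>A\<close>, the values of
  \<open>N\<close> are partial sums of increments. Hence \<open>A\<close> depends only on the
  increments before \<open>t\<close>, which are jointly independent of the next one.\<close>

lemma past_events_indep_increment:
  assumes A: "A \<in> past_events t" and t: "0 \<le> t" and h: "0 < h"
  shows "prob (A \<inter> {\<omega> \<in> space M. N (t + h) \<omega> - N t \<omega> \<in> B}) =
    prob A * prob {\<omega> \<in> space M. N (t + h) \<omega> - N t \<omega> \<in> B}"
proof -
  obtain I P where A: "A = {\<omega> \<in> space M. \<forall>s\<in>I. P s (N s \<omega>)}" "finite I" "I \<subseteq> {0..t}"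
    using A by (auto simp: past_events_def)
  \<comment> \<open>Inserting 0 and \<open>t\<close> makes the grid start where \<open>N\<close>
    vanishes and end where the last increment begins.\<close>
  define xs where "xs = sorted_list_of_set (insert 0 (insert t I))"
  define m where "m = length xs - 1"
  \<comment> \<open>Beyond index \<open>m\<close> the grid is constantly \<open>t + h\<close>, which
    keeps it monotone; the increment with index \<open>m\<close> is the one over
    \<open>[t, t + h]\<close>.\<close>
  define \<tau> where "\<tau> i = (if i \<le> m then xs ! i else t + h)" for i
  have set_xs: "set xs = insert 0 (insert t I)" and sorted: "sorted xs"
    using A(2) unfolding xs_def
    by (simp_all only: set_sorted_list_of_set sorted_sorted_list_of_set finite_insert)
  have len: "length xs = Suc m"
    using set_xs by (cases xs) (auto simp: m_def)
  have in_xs: "xs ! i \<in> {0..t}" if "i \<le> m" for i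
    using nth_mem[of i xs] that len set_xs A(3) t by auto
  have nth_xs: "\<exists>i\<le>m. xs ! i = s" if "s \<in> insert 0 (insert t I)" for s
    using that unfolding set_xs[symmetric] in_set_conv_nth len less_Suc_eq_le by blast
  obtain i0 where i0: "i0 \<le> m" "xs ! i0 = 0"
    using nth_xs[of 0] by blast
  obtain i1 where i1: "i1 \<le> m" "xs ! i1 = t"
    using nth_xs[of t] by blast
  have \<tau>_0: "\<tau> 0 = 0"
    using sorted_nth_mono[OF sorted, of 0 i0] i0 len in_xs[of 0] by (simp add: \<tau>_def)
  have \<tau>_m: "\<tau> m = t"
    using sorted_nth_mono[OF sorted, of i1 m] i1 len in_xs[of m] by (simp add: \<tau>_def)
  have \<tau>_mono: "\<tau> i \<le> \<tau> j" if "i \<le> j" for i j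
    using sorted_nth_mono[OF sorted that] that in_xs[of i] h len by (auto simp: \<tau>_def)
  have \<tau>_nonneg: "0 \<le> \<tau> i" for i
    using \<tau>_mono[of 0 i] by (simp add: \<tau>_0)
  define D where "D i \<omega> = N (\<tau> (Suc i)) \<omega> - N (\<tau> i) \<omega>" for i \<omega>
  have "indep_vars (\<lambda>_. count_space UNIV) D {..<Suc m}"
    unfolding D_def by (intro independent_increments) (auto simp: \<tau>_0 \<tau>_mono intro!: mono_onI)
  then have indep: "indep_var (PiM {..<m} (\<lambda>_. count_space UNIV)) (\<lambda>\<omega>. restrict (\<lambda>i. D i \<omega>) {..<m})
      (PiM {m} (\<lambda>_. count_space UNIV)) (\<lambda>\<omega>. restrict (\<lambda>i. D i \<omega>) {m})"
    by (rule indep_var_restrict) auto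
  have telescope: "N (\<tau> i) \<omega> = (\<Sum>j<i. D j \<omega>)" if "\<omega> \<in> space M" for i \<omega>
  proof (induction i)
    case 0
    then show ?case
      using counting_zero[OF that] by (simp add: \<tau>_0)
  next
    case (Suc i)
    then show ?case
      using counting_le[OF that \<tau>_nonneg \<tau>_mono[of i "Suc i"]] by (simp add: D_def)
  qed
  \<comment> \<open>The event \<open>A\<close> is rewritten as a set of increment vectors, the
    values of \<open>N\<close> being recovered as partial sums.\<close>
  define Xa where "Xa = {f \<in> PiE {..<m} (\<lambda>_. UNIV). \<forall>i\<le>m. \<tau> i \<in> I \<longrightarrow> P (\<tau> i) (\<Sum>j<i. f j :: nat)}"
  define Xb where "Xb = {f \<in> PiE {m} (\<lambda>_. UNIV). f m \<in> B}"
  have "(\<forall>s\<in>I. P s (N s \<omega>)) \<longleftrightarrow> (\<forall>i\<le>m. \<tau> i \<in> I \<longrightarrow> P (\<tau> i) (\<Sum>j<i. restrict (\<lambda>i. D i \<omega>) {..<m} j))"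
    if w: "\<omega> \<in> space M" for \<omega>
  proof -
    have "(\<Sum>j<i. restrict (\<lambda>i. D i \<omega>) {..<m} j) = N (\<tau> i) \<omega>" if "i \<le> m" for i
      unfolding telescope[OF w] using that by (intro sum.cong) auto
    moreover have "\<exists>i\<le>m. \<tau> i = s" if "s \<in> I" for s
      using nth_xs[of s] that by (auto simp: \<tau>_def)
    ultimately show ?thesis
      by auto
  qed
  then have A_eq: "(\<lambda>\<omega>. restrict (\<lambda>i. D i \<omega>) {..<m}) -` Xa \<inter> space M = A"
    unfolding A(1) Xa_def by (auto simp del: restrict_apply)
  have B_eq: "(\<lambda>\<omega>. restrict (\<lambda>i. D i \<omega>) {m}) -` Xb \<inter> space M =
      {\<omega> \<in> space M. N (t + h) \<omega> - N t \<omega> \<in> B}"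
    unfolding Xb_def using \<tau>_m by (auto simp: D_def \<tau>_def[of "Suc m"])
  have "Xa \<in> sets (PiM {..<m} (\<lambda>_. count_space UNIV))" "Xb \<in> sets (PiM {m} (\<lambda>_. count_space UNIV))"
    by (auto simp: count_space_PiM_finite Xa_def Xb_def)
  note indep_varD[OF indep this, unfolded A_eq B_eq]
  moreover have "(\<lambda>\<omega>. (restrict (\<lambda>i. D i \<omega>) {..<m}, restrict (\<lambda>i. D i \<omega>) {m})) -` (Xa \<times> Xb) \<inter> space M =
      A \<inter> {\<omega> \<in> space M. N (t + h) \<omega> - N t \<omega> \<in> B}"
    unfolding A_eq[symmetric] B_eq[symmetric] by blast
  ultimately show ?thesis
    by (simp only:)
qed

lemma increment_measurable:
  assumes "0 \<le> t" "0 \<le> h"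
  shows "(\<lambda>\<omega>. N (t + h) \<omega> - N t \<omega>) \<in> measurable M (count_space UNIV)"
proof -
  have [measurable]: "N (t + h) \<in> measurable M (count_space UNIV)" "N t \<in> measurable M (count_space UNIV)"
    using assms by (auto intro: counting_measurable)
  show ?thesis
    by measurable
qed

text \<open>Independence passes from the two intersection-stable generators to the generated
  sigma-algebras, and \<open>Z\<close> generates a sub-sigma-algebra of
  \<open>past t\<close>.\<close>

lemma past_indep_increment:
  fixes Z :: "'a \<Rightarrow> real"
  assumes Z: "Z \<in> borel_measurable (past t)" and t: "0 \<le> t" and h: "0 < h"
  shows "indep_var borel Z borel (\<lambda>\<omega>. real (N (t + h) \<omega> - N t \<omega>))"
proof -
  let ?D = "\<lambda>\<omega>. N (t + h) \<omega> - N t \<omega>"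
  let ?G = "{?D -` B \<inter> space M | B. B \<in> sets (count_space UNIV)}"
  have D: "?D \<in> measurable M (count_space UNIV)"
    using t h by (intro increment_measurable) auto
  have vim: "?D -` B \<inter> space M = {\<omega> \<in> space M. ?D \<omega> \<in> B}" for B
    by auto
  have "indep_set (past_events t) ?G"
  proof (rule indep_setI)
    show "past_events t \<subseteq> events"
      by (rule past_events_subset)
    show "?G \<subseteq> events"
      using measurable_sets[OF D] by auto
    show "prob (a \<inter> b) = prob a * prob b" if "a \<in> past_events t" "b \<in> ?G" for a b
      using that past_events_indep_increment[OF that(1) t h] by (auto simp: vim)
  qed
  moreover have "Int_stable ?G"
  proof (rule Int_stableI)
    fix a b
    assume "a \<in> ?G" "b \<in> ?G"
    then obtain A B where "a = ?D -` A \<inter> space M" "b = ?D -` B \<inter> space M"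
      by auto
    then have "a \<inter> b = ?D -` (A \<inter> B) \<inter> space M"
      by auto
    then show "a \<inter> b \<in> ?G"
      by (intro CollectI exI[of _ "A \<inter> B"] conjI) simp_all
  qed
  ultimately have "indep_set (sets (past t)) (sigma_sets (space M) ?G)"
    unfolding sets_past by (intro indep_set_sigma_sets Int_stable_past_events)
  moreover have "sigma_sets (space M) {Z -` A \<inter> space M | A. A \<in> sets borel} \<subseteq> sets (past t)"
  proof -
    have "{Z -` A \<inter> space M | A. A \<in> sets borel} \<subseteq> sets (past t)"
      using measurable_sets[OF Z] by auto
    from sets.sigma_sets_subset[OF this] show ?thesis
      by simp
  qed
  moreover have "sigma_sets (space M) {(\<lambda>\<omega>. real (?D \<omega>)) -` A \<inter> space M | A. A \<in> sets borel} \<subseteq>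
      sigma_sets (space M) ?G"
  proof (intro sigma_sets_mono' subsetI)
    fix a
    assume "a \<in> {(\<lambda>\<omega>. real (?D \<omega>)) -` A \<inter> space M | A. A \<in> sets borel}"
    then obtain A where "a = ?D -` (real -` A) \<inter> space M"
      by (auto simp: vimage_def)
    then show "a \<in> ?G"
      by (intro CollectI exI[of _ "real -` A"] conjI) simp_all
  qed
  ultimately have "indep_set (sigma_sets (space M) {Z -` A \<inter> space M | A. A \<in> sets borel})
      (sigma_sets (space M) {(\<lambda>\<omega>. real (?D \<omega>)) -` A \<inter> space M | A. A \<in> sets borel})"
    unfolding indep_sets2_eq by blast
  moreover have "(\<lambda>\<omega>. real (?D \<omega>)) \<in> borel_measurable M"
    using measurable_compose[OF D, of real borel] by simp
  ultimately show ?thesis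
    unfolding indep_var_eq using measurable_from_subalg[OF subalgebra_past Z] by blast
qed

section \<open>Expansion of expectations over a short interval\<close>

lemma prob_increment:
  assumes "0 \<le> t" "0 < h"
  shows "prob {\<omega> \<in> space M. N (t + h) \<omega> - N t \<omega> = k} = (rate * h) ^ k / fact k * exp (- (rate * h))"
proof -
  let ?D = "\<lambda>\<omega>. N (t + h) \<omega> - N t \<omega>"
  have "prob {\<omega> \<in> space M. ?D \<omega> = k} = measure (distr M (count_space UNIV) ?D) {k}"
    using assms by (subst measure_distr) (auto intro!: increment_measurable arg_cong[of _ _ prob])
  also have "\<dots> = pmf (poisson_pmf (rate * h)) k"
    using poisson_increments[of t "t + h"] assms by (simp add: measure_pmf_single)
  finally show ?thesis
    using rate_pos assms by simp
qed

text \<open>The expectation of the product factorises by independence, and the indicator contributes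
  the Poisson probability of one event.\<close>

lemma expectation_past_increment:
  fixes Z :: "'a \<Rightarrow> real"
  assumes Z: "Z \<in> borel_measurable (past t)" and bdd: "\<And>\<omega>. \<omega> \<in> space M \<Longrightarrow> \<bar>Z \<omega>\<bar> \<le> K"
    and t: "0 \<le> t" and h: "0 < h"
  shows "expectation (\<lambda>\<omega>. Z \<omega> * indicator {1} (N (t + h) \<omega> - N t \<omega>)) =
    expectation Z * (rate * h * exp (- (rate * h)))"
proof -
  let ?D = "\<lambda>\<omega>. N (t + h) \<omega> - N t \<omega>"
  let ?I = "\<lambda>\<omega>. indicator {1} (?D \<omega>) :: real"
  have D[measurable]: "?D \<in> measurable M (count_space UNIV)"
    using t h by (intro increment_measurable) auto
  have [measurable]: "Z \<in> borel_measurable M"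
    using measurable_from_subalg[OF subalgebra_past Z] .
  have "indep_var borel Z borel ?I"
    using indep_var_compose[OF past_indep_increment[OF Z t h], of "\<lambda>x. x" borel "indicator {1}" borel]
    by (simp add: comp_def indicator_def cong: if_cong)
  moreover have "integrable M Z"
    using bdd by (intro integrable_const_bound[of _ K]) auto
  moreover have "integrable M ?I"
    by (intro integrable_const_bound[of _ 1]) (auto simp: indicator_def)
  ultimately have "expectation (\<lambda>\<omega>. Z \<omega> * ?I \<omega>) = expectation Z * expectation ?I"
    by (intro indep_var_lebesgue_integral)
  also have "expectation ?I = expectation (indicator {\<omega> \<in> space M. ?D \<omega> = 1})"
    by (intro Bochner_Integration.integral_cong) (auto simp: indicator_def)
  also have "\<dots> = prob {\<omega> \<in> space M. ?D \<omega> = 1}"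
    by simp
  finally show ?thesis
    using prob_increment[OF t h, of 1] by simp
qed

text \<open>The complementary probability is \<open>(1 + \<mu>) * exp (- \<mu>)\<close> with
  \<open>\<mu> = rate * h\<close>, and \<open>exp (- \<mu>) \<ge> 1 - \<mu>\<close>.\<close>

lemma prob_two_events:
  assumes t: "0 \<le> t" and h: "0 < h"
  shows "prob {\<omega> \<in> space M. 2 \<le> N (t + h) \<omega> - N t \<omega>} \<le> (rate * h)\<^sup>2"
proof -
  let ?D = "\<lambda>\<omega>. N (t + h) \<omega> - N t \<omega>"
  let ?\<mu> = "rate * h"
  have [measurable]: "?D \<in> measurable M (count_space UNIV)"
    using t h by (intro increment_measurable) auto
  have "space M = {\<omega> \<in> space M. 2 \<le> ?D \<omega>} \<union> ({\<omega> \<in> space M. ?D \<omega> = 0} \<union> {\<omega> \<in> space M. ?D \<omega> = 1})"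
    by auto
  then have "1 = prob ({\<omega> \<in> space M. 2 \<le> ?D \<omega>} \<union> ({\<omega> \<in> space M. ?D \<omega> = 0} \<union> {\<omega> \<in> space M. ?D \<omega> = 1}))"
    using prob_space by metis
  also have "\<dots> = prob {\<omega> \<in> space M. 2 \<le> ?D \<omega>} + (prob {\<omega> \<in> space M. ?D \<omega> = 0} + prob {\<omega> \<in> space M. ?D \<omega> = 1})"
    by (subst finite_measure_Union, measurable, force, subst finite_measure_Union, measurable, auto)
  finally have "prob {\<omega> \<in> space M. 2 \<le> ?D \<omega>} = 1 - (1 + ?\<mu>) * exp (- ?\<mu>)"
    using prob_increment[OF t h, of 0] prob_increment[OF t h, of 1] by (simp add: algebra_simps)
  also have "\<dots> \<le> 1 - (1 + ?\<mu>) * (1 - ?\<mu>)"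
    using exp_ge_add_one_self[of "- ?\<mu>"] rate_pos h by (intro diff_left_mono mult_left_mono) auto
  also have "\<dots> = ?\<mu>\<^sup>2"
    by (simp add: power2_eq_square algebra_simps)
  finally show ?thesis .
qed

text \<open>\<open>A\<close> is the drift between events and \<open>J\<close> the jump at an event.
  The remainder is of order \<open>h\<^sup>2\<close> without an event, of order \<open>h\<close> on
  one event, whose probability is of order \<open>h\<close>, and bounded on several events, whose
  probability is of order \<open>h\<^sup>2\<close>.\<close>

lemma expectation_increment:
  fixes Z Z' A J :: "'a \<Rightarrow> real"
  assumes t: "0 \<le> t" and h: "0 < h" "h \<le> T"
    and Z': "Z' \<in> borel_measurable M"
    and past: "Z \<in> borel_measurable (past t)" "A \<in> borel_measurable (past t)" "J \<in> borel_measurable (past t)"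
    and bdd: "\<And>\<omega>. \<omega> \<in> space M \<Longrightarrow> \<bar>Z' \<omega>\<bar> \<le> K" "\<And>\<omega>. \<omega> \<in> space M \<Longrightarrow> \<bar>Z \<omega>\<bar> \<le> K"
      "\<And>\<omega>. \<omega> \<in> space M \<Longrightarrow> \<bar>A \<omega>\<bar> \<le> K" "\<And>\<omega>. \<omega> \<in> space M \<Longrightarrow> \<bar>J \<omega>\<bar> \<le> K"
    and no_event: "\<And>\<omega>. \<omega> \<in> space M \<Longrightarrow> N (t + h) \<omega> - N t \<omega> = 0 \<Longrightarrow> \<bar>Z' \<omega> - Z \<omega> - h * A \<omega>\<bar> \<le> K * h\<^sup>2"
    and one_event: "\<And>\<omega>. \<omega> \<in> space M \<Longrightarrow> N (t + h) \<omega> - N t \<omega> = 1 \<Longrightarrow> \<bar>Z' \<omega> - Z \<omega> - J \<omega>\<bar> \<le> K * h"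
  shows "\<bar>expectation Z' - expectation Z - h * (expectation A + rate * expectation J)\<bar>
    \<le> K * (1 + 2 * rate + (3 + T) * rate\<^sup>2) * h\<^sup>2"
proof -
  let ?D = "\<lambda>\<omega>. N (t + h) \<omega> - N t \<omega>"
  let ?I = "\<lambda>\<omega>. indicator {1} (?D \<omega>) :: real"
  let ?\<mu> = "rate * h"
  let ?P1 = "?\<mu> * exp (- ?\<mu>)"
  let ?E1 = "{\<omega> \<in> space M. ?D \<omega> = 1}"
  let ?E2 = "{\<omega> \<in> space M. 2 \<le> ?D \<omega>}"
  have [measurable]: "?D \<in> measurable M (count_space UNIV)"
    using t h by (intro increment_measurable) auto
  note [measurable] = Z' past[THEN measurable_from_subalg[OF subalgebra_past]]
  have K: "0 \<le> K"
    using bdd(1) not_empty by (force intro: order.trans[OF abs_ge_zero])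
  have int: "integrable M Z'" "integrable M Z" "integrable M A" "integrable M J"
    using bdd by (auto intro!: integrable_const_bound[of _ K])
  have int_ind: "integrable M (indicator ?E1 :: 'a \<Rightarrow> real)" "integrable M (indicator ?E2 :: 'a \<Rightarrow> real)"
    by (rule integrable_const_bound[of _ 1]; simp)+
  have int_JI: "integrable M (\<lambda>\<omega>. J \<omega> * ?I \<omega>)"
    using bdd(4) K by (intro integrable_const_bound[of _ K]) (auto simp: indicator_def)
  define R where "R \<omega> = Z' \<omega> - Z \<omega> - h * A \<omega> - J \<omega> * ?I \<omega>" for \<omega>
  \<comment> \<open>The 2 for one event is the assumed error plus the drift term
    \<open>h * A\<close>. The \<open>2 + T\<close> for several events bounds \<open>Z'\<close>,
    \<open>Z\<close> and, by \<open>h \<le> T\<close>, the drift term.\<close>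
  define B where "B \<omega> = K * h\<^sup>2 + 2 * K * h * indicator ?E1 \<omega> + (2 + T) * K * indicator ?E2 \<omega>" for \<omega>
  have hA: "\<bar>h * A \<omega>\<bar> \<le> h * K" if "\<omega> \<in> space M" for \<omega>
    using bdd(3)[OF that] h by (simp add: abs_mult)
  have "\<bar>R \<omega>\<bar> \<le> B \<omega>" if w: "\<omega> \<in> space M" for \<omega>
  proof -
    consider "?D \<omega> = 0" | "?D \<omega> = 1" | "2 \<le> ?D \<omega>"
      by linarith
    then show ?thesis
    proof cases
      case 1
      then show ?thesis
        using no_event[OF w] by (simp add: R_def B_def)
    next
      case 2
      then have "\<bar>R \<omega>\<bar> \<le> \<bar>Z' \<omega> - Z \<omega> - J \<omega>\<bar> + \<bar>h * A \<omega>\<bar>"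
        by (simp add: R_def)
      also have "\<dots> \<le> K * h + h * K"
        using one_event[OF w 2] hA[OF w] by (rule add_mono)
      finally have "\<bar>R \<omega>\<bar> \<le> K * h + h * K" .
      moreover have "B \<omega> = K * h\<^sup>2 + 2 * K * h"
        using 2 w by (simp add: B_def)
      moreover have "0 \<le> K * h\<^sup>2"
        using K by simp
      ultimately show ?thesis
        by (simp add: algebra_simps)
    next
      case 3
      have "\<bar>R \<omega>\<bar> \<le> K + K + h * K"
        using bdd(1,2)[OF w] hA[OF w] 3 by (simp add: R_def abs_le_iff)
      also have "\<dots> \<le> K + K + T * K"
        using h K by (simp add: mult_right_mono)
      finally have "\<bar>R \<omega>\<bar> \<le> K + K + T * K" .
      moreover have "B \<omega> = K * h\<^sup>2 + (2 + T) * K"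
        using 3 w by (simp add: B_def)
      moreover have "0 \<le> K * h\<^sup>2"
        using K by simp
      ultimately show ?thesis
        by (simp add: algebra_simps)
    qed
  qed
  moreover have "integrable M R" "integrable M B"
    unfolding R_def B_def using int int_JI int_ind
    by (auto intro!: Bochner_Integration.integrable_add)
  ultimately have "\<bar>expectation R\<bar> \<le> expectation B"
    by (intro order.trans[OF integral_abs_bound] integral_mono) auto
  also have "expectation B = K * h\<^sup>2 + 2 * K * h * prob ?E1 + (2 + T) * K * prob ?E2"
    unfolding B_def using int_ind by (simp add: prob_space)
  also have "\<dots> \<le> K * h\<^sup>2 + 2 * K * h * ?\<mu> + (2 + T) * K * ?\<mu>\<^sup>2"
  proof -
    have "prob ?E1 \<le> ?\<mu>"
      using prob_increment[OF t h(1), of 1] h rate_pos by (simp add: mult_le_cancel_left1)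
    then show ?thesis
      using prob_two_events[OF t h(1)] K h by (intro add_mono mult_left_mono) auto
  qed
  finally have R_bound: "\<bar>expectation R\<bar> \<le> K * h\<^sup>2 + 2 * K * h * ?\<mu> + (2 + T) * K * ?\<mu>\<^sup>2" .
  have "expectation R = expectation Z' - expectation Z - h * expectation A - expectation J * ?P1"
    unfolding R_def using int int_JI expectation_past_increment[OF past(3) bdd(4) t h(1)] by simp
  then have "expectation Z' - expectation Z - h * (expectation A + rate * expectation J) =
      expectation R - expectation J * (?\<mu> - ?P1)"
    by (simp add: algebra_simps)
  \<comment> \<open>Replacing the exact probability of one event by \<open>rate * h\<close> costs
    one more \<open>rate\<^sup>2\<close>, which turns \<open>2 + T\<close> into
    \<open>3 + T\<close>.\<close>
  moreover have "\<bar>expectation J * (?\<mu> - ?P1)\<bar> \<le> K * ?\<mu>\<^sup>2"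
  proof -
    have "\<bar>expectation J\<bar> \<le> expectation (\<lambda>_. K)"
      using int bdd(4) by (intro order.trans[OF integral_abs_bound] integral_mono) auto
    then have "\<bar>expectation J\<bar> \<le> K"
      by (simp add: prob_space)
    moreover have "?\<mu> - ?P1 = ?\<mu> * (1 - exp (- ?\<mu>))"
      by (simp add: algebra_simps)
    moreover have "\<bar>?\<mu> * (1 - exp (- ?\<mu>))\<bar> \<le> ?\<mu> * ?\<mu>"
      using exp_ge_add_one_self[of "- ?\<mu>"] h rate_pos by (simp add: abs_mult)
    ultimately show ?thesis
      using K by (simp add: abs_mult mult_mono power2_eq_square)
  qed
  ultimately have "\<bar>expectation Z' - expectation Z - h * (expectation A + rate * expectation J)\<bar>
      \<le> K * h\<^sup>2 + 2 * K * h * ?\<mu> + (2 + T) * K * ?\<mu>\<^sup>2 + K * ?\<mu>\<^sup>2"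
    using R_bound by linarith
  then show ?thesis
    by (simp add: power2_eq_square algebra_simps)
qed

section \<open>The linear system for the means\<close>

lemma no_event_path:
  assumes "\<omega> \<in> space M" "0 \<le> t" "0 < h" "N (t + h) \<omega> - N t \<omega> = 0"
  shows "N (t + h) \<omega> = N t \<omega>"
  using counting_le[of \<omega> t "t + h"] assms by simp

lemma one_event_path:
  assumes w: "\<omega> \<in> space M" and t: "0 \<le> t" and h: "0 < h" and one: "N (t + h) \<omega> - N t \<omega> = 1"
  shows "N (t + h) \<omega> = Suc (N t \<omega>)"
    and "t \<le> event_time N (Suc (N t \<omega>)) \<omega>" and "event_time N (Suc (N t \<omega>)) \<omega> \<le> t + h"
proof -
  show *: "N (t + h) \<omega> = Suc (N t \<omega>)"
    using one by simp
  have "event_time N (Suc (N t \<omega>)) \<omega> \<le> s \<longleftrightarrow> Suc (N t \<omega>) \<le> N s \<omega>" if "0 \<le> s" for s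
    using t h * by (intro event_time_le_iff[OF w that, of "t + h"]) auto
  from this[of t] this[of "t + h"] show "t \<le> event_time N (Suc (N t \<omega>)) \<omega>" "event_time N (Suc (N t \<omega>)) \<omega> \<le> t + h"
    using t h * by auto
qed

lemma leaf_process_measurable: "0 \<le> t \<Longrightarrow> leaf_process b c N t \<in> borel_measurable M"
  by (rule measurable_from_subalg[OF subalgebra_past leaf_process_measurable_past])

lemma cloud_process_measurable: "0 \<le> t \<Longrightarrow> cloud_process b c N t \<in> borel_measurable M"
  by (rule measurable_from_subalg[OF subalgebra_past cloud_process_measurable_past])

lemma leaf_process_integrable: "0 \<le> c \<Longrightarrow> 0 \<le> t \<Longrightarrow> integrable M (leaf_process b c N t)"
  using abs_leaf_process_le leaf_process_measurable
  by (intro integrable_const_bound[of _ "exp (c * t)"]) auto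

lemma cloud_process_integrable: "0 \<le> c \<Longrightarrow> 0 \<le> t \<Longrightarrow> integrable M (cloud_process b c N t)"
  using abs_cloud_process_le cloud_process_measurable
  by (intro integrable_const_bound[of _ "exp (c * t)"]) auto

definition mean_leaf :: "real \<Rightarrow> bool \<Rightarrow> real \<Rightarrow> real" where
  "mean_leaf c b t = expectation (leaf_process b c N t)"

definition mean_cloud :: "real \<Rightarrow> bool \<Rightarrow> real \<Rightarrow> real" where
  "mean_cloud c b t = expectation (cloud_process b c N t)"

text \<open>This is the mean drift between events plus the rate times the mean jump. The factor
  \<open>hyp b 0 / 2\<close> is one half for the \<open>cosh\<close> part and zero for the
  \<open>sinh\<close> part.\<close>

definition leaf_drift :: "real \<Rightarrow> bool \<Rightarrow> real \<Rightarrow> real" where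
  "leaf_drift c b t = c * mean_leaf c (\<not> b) t + rate * (hyp b 0 / 2 * mean_leaf c True t - mean_leaf c b t)"

definition cloud_drift :: "real \<Rightarrow> bool \<Rightarrow> real \<Rightarrow> real" where
  "cloud_drift c b t = c * mean_cloud c (\<not> b) t + rate * (hyp b 0 / 2 * mean_leaf c True t - mean_leaf c b t / 2)"

lemma abs_mean_le:
  assumes "0 \<le> c" "0 \<le> t" "t \<le> T"
  shows "\<bar>mean_leaf c b t\<bar> \<le> exp (c * T)" and "\<bar>mean_cloud c b t\<bar> \<le> exp (c * T)"
proof -
  have *: "\<bar>expectation f\<bar> \<le> exp (c * t)"
    if "integrable M f" "\<And>\<omega>. \<omega> \<in> space M \<Longrightarrow> \<bar>f \<omega>\<bar> \<le> exp (c * t)" for f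
  proof -
    have "\<bar>expectation f\<bar> \<le> expectation (\<lambda>_. exp (c * t))"
      using that by (intro order.trans[OF integral_abs_bound] integral_mono) auto
    then show ?thesis
      by (simp add: prob_space)
  qed
  have "exp (c * t) \<le> exp (c * T)"
    using assms by (simp add: mult_left_mono)
  then show "\<bar>mean_leaf c b t\<bar> \<le> exp (c * T)" "\<bar>mean_cloud c b t\<bar> \<le> exp (c * T)"
    unfolding mean_leaf_def mean_cloud_def
    using *[OF leaf_process_integrable[OF assms(1,2)] abs_leaf_process_le[OF assms(1) _ assms(2)], of b]
      *[OF cloud_process_integrable[OF assms(1,2)] abs_cloud_process_le[OF assms(1) _ assms(2)], of b]
    by linarith+
qed

text \<open>A single constant serves every bound that \<open>expectation_increment\<close> asks for,
  both for the leaf and for the cloud.\<close>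

lemma error_constants:
  assumes "0 \<le> (c :: real)" "0 \<le> E"
  defines "K \<equiv> (2 + 3 * c + c\<^sup>2) * E"
  shows "E \<le> K" "2 * E \<le> K" "c * E \<le> K" "2 * c * E \<le> K" "3 * c * E \<le> K" "c\<^sup>2 * E \<le> K"
proof -
  have "0 \<le> c * E" "0 \<le> c\<^sup>2 * E"
    using assms by auto
  then show "E \<le> K" "2 * E \<le> K" "c * E \<le> K" "2 * c * E \<le> K" "3 * c * E \<le> K" "c\<^sup>2 * E \<le> K"
    using assms(2) unfolding K_def by (simp_all add: algebra_simps)
qed

text \<open>The constant depends on \<open>T\<close> but not on \<open>t\<close> or
  \<open>h\<close>, which is the uniformity that differentiation from forward increments
  requires.\<close>

lemma mean_leaf_increment:
  assumes c: "0 \<le> c" and t: "0 \<le> t" and h: "0 < h" and T: "t + h \<le> T"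
  shows "\<bar>mean_leaf c b (t + h) - mean_leaf c b t - h * leaf_drift c b t\<bar>
    \<le> (2 + 3 * c + c\<^sup>2) * exp (c * T) * (1 + 2 * rate + (3 + T) * rate\<^sup>2) * h\<^sup>2"
proof -
  define E where "E = exp (c * T)"
  define K where "K = (2 + 3 * c + c\<^sup>2) * E"
  let ?A = "\<lambda>\<omega>. c * leaf_process (\<not> b) c N t \<omega>"
  let ?J = "\<lambda>\<omega>. hyp b 0 / 2 * leaf_process True c N t \<omega> - leaf_process b c N t \<omega>"
  have E: "0 \<le> E" and E_ge: "exp (c * t) \<le> E" "exp (c * (t + h)) \<le> E"
    using c T h by (auto simp: E_def mult_left_mono)
  note K = error_constants[OF c E, folded K_def]
  note bound = abs_leaf_process_le[OF c _ t, THEN order.trans, OF _ E_ge(1)]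
  note [measurable] = leaf_process_measurable_past[OF t]
  have "\<bar>expectation (leaf_process b c N (t + h)) - expectation (leaf_process b c N t) -
      h * (expectation ?A + rate * expectation ?J)\<bar> \<le> K * (1 + 2 * rate + (3 + T) * rate\<^sup>2) * h\<^sup>2"
  proof (rule expectation_increment[OF t h])
    show "h \<le> T"
      using t T by simp
    show "leaf_process b c N (t + h) \<in> borel_measurable M"
      using t h by (intro leaf_process_measurable) auto
    fix \<omega>
    assume w: "\<omega> \<in> space M"
    show "\<bar>leaf_process b c N (t + h) \<omega>\<bar> \<le> K"
      using abs_leaf_process_le[OF c w, of "t + h" b] E_ge K(1) t h by linarith
    show "\<bar>leaf_process b c N t \<omega>\<bar> \<le> K"
      using bound[OF w] K(1) by (rule order.trans)
    show "\<bar>?A \<omega>\<bar> \<le> K"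
      using mult_left_mono[OF bound[OF w, of "\<not> b"] c] K(3) c by (simp add: abs_mult)
    have "\<bar>hyp b 0 / 2 * leaf_process True c N t \<omega>\<bar> \<le> E"
      using bound[OF w, of True] E by (simp add: hyp_zero)
    then show "\<bar>?J \<omega>\<bar> \<le> K"
      using bound[OF w, of b] K(2) by linarith
    note ev = events_until_path[OF w t]
    show "\<bar>leaf_process b c N (t + h) \<omega> - leaf_process b c N t \<omega> - h * ?A \<omega>\<bar> \<le> K * h\<^sup>2"
      if "N (t + h) \<omega> - N t \<omega> = 0"
    proof -
      have "c\<^sup>2 * exp (c * (t + h)) * h\<^sup>2 \<le> K * h\<^sup>2"
        using E_ge(2) K(6) by (intro mult_right_mono order.trans[OF mult_left_mono K(6)]) auto
      then show ?thesis
        using leaf_no_event[OF c ev, of h b] h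
        unfolding leaf_process_def no_event_path[OF w t h that] by linarith
    qed
    show "\<bar>leaf_process b c N (t + h) \<omega> - leaf_process b c N t \<omega> - ?J \<omega>\<bar> \<le> K * h"
      if "N (t + h) \<omega> - N t \<omega> = 1"
    proof -
      have "2 * c * exp (c * (t + h)) * h \<le> K * h"
        using E_ge(2) h c by (intro mult_right_mono order.trans[OF mult_left_mono K(4)]) auto
      then show ?thesis
        using leaf_event[OF c ev one_event_path(2,3)[OF w t h that], of b]
        unfolding leaf_process_def one_event_path(1)[OF w t h that] by linarith
    qed
  qed measurable
  moreover have "expectation ?A = c * mean_leaf c (\<not> b) t"
    by (simp add: mean_leaf_def)
  moreover have "expectation ?J = hyp b 0 / 2 * mean_leaf c True t - mean_leaf c b t"
    using leaf_process_integrable[OF c t] by (simp add: mean_leaf_def)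
  ultimately show ?thesis
    by (simp only: leaf_drift_def mean_leaf_def K_def E_def)
qed

lemma mean_cloud_increment:
  assumes c: "0 \<le> c" and t: "0 \<le> t" and h: "0 < h" and T: "t + h \<le> T"
  shows "\<bar>mean_cloud c b (t + h) - mean_cloud c b t - h * cloud_drift c b t\<bar>
    \<le> (2 + 3 * c + c\<^sup>2) * exp (c * T) * (1 + 2 * rate + (3 + T) * rate\<^sup>2) * h\<^sup>2"
proof -
  define E where "E = exp (c * T)"
  define K where "K = (2 + 3 * c + c\<^sup>2) * E"
  let ?A = "\<lambda>\<omega>. c * cloud_process (\<not> b) c N t \<omega>"
  let ?J = "\<lambda>\<omega>. hyp b 0 / 2 * leaf_process True c N t \<omega> - leaf_process b c N t \<omega> / 2"
  have E: "0 \<le> E" and E_ge: "exp (c * t) \<le> E" "exp (c * (t + h)) \<le> E"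
    using c T h by (auto simp: E_def mult_left_mono)
  note K = error_constants[OF c E, folded K_def]
  note leaf_bound = abs_leaf_process_le[OF c _ t, THEN order.trans, OF _ E_ge(1)]
  note bound = abs_cloud_process_le[OF c _ t, THEN order.trans, OF _ E_ge(1)]
  note [measurable] = leaf_process_measurable_past[OF t] cloud_process_measurable_past[OF t]
  have "\<bar>expectation (cloud_process b c N (t + h)) - expectation (cloud_process b c N t) -
      h * (expectation ?A + rate * expectation ?J)\<bar> \<le> K * (1 + 2 * rate + (3 + T) * rate\<^sup>2) * h\<^sup>2"
  proof (rule expectation_increment[OF t h])
    show "h \<le> T"
      using t T by simp
    show "cloud_process b c N (t + h) \<in> borel_measurable M"
      using t h by (intro cloud_process_measurable) auto
    fix \<omega>
    assume w: "\<omega> \<in> space M"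
    show "\<bar>cloud_process b c N (t + h) \<omega>\<bar> \<le> K"
      using abs_cloud_process_le[OF c w, of "t + h" b] E_ge K(1) t h by linarith
    show "\<bar>cloud_process b c N t \<omega>\<bar> \<le> K"
      using bound[OF w] K(1) by (rule order.trans)
    show "\<bar>?A \<omega>\<bar> \<le> K"
      using mult_left_mono[OF bound[OF w, of "\<not> b"] c] K(3) c by (simp add: abs_mult)
    have "\<bar>hyp b 0 / 2 * leaf_process True c N t \<omega>\<bar> \<le> E"
      using leaf_bound[OF w, of True] E by (simp add: hyp_zero)
    then show "\<bar>?J \<omega>\<bar> \<le> K"
      using leaf_bound[OF w, of b] K(2) by linarith
    note ev = events_until_path[OF w t]
    show "\<bar>cloud_process b c N (t + h) \<omega> - cloud_process b c N t \<omega> - h * ?A \<omega>\<bar> \<le> K * h\<^sup>2"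
      if "N (t + h) \<omega> - N t \<omega> = 0"
    proof -
      have "c\<^sup>2 * exp (c * (t + h)) * h\<^sup>2 \<le> K * h\<^sup>2"
        using E_ge(2) by (intro mult_right_mono order.trans[OF mult_left_mono K(6)]) auto
      then show ?thesis
        using cloud_no_event[OF c ev, of h b] h
        unfolding cloud_process_def no_event_path[OF w t h that] by linarith
    qed
    show "\<bar>cloud_process b c N (t + h) \<omega> - cloud_process b c N t \<omega> - ?J \<omega>\<bar> \<le> K * h"
      if "N (t + h) \<omega> - N t \<omega> = 1"
    proof -
      have "3 * c * exp (c * (t + h)) * h \<le> K * h"
        using E_ge(2) h c by (intro mult_right_mono order.trans[OF mult_left_mono K(5)]) auto
      then show ?thesis
        using cloud_event[OF c ev one_event_path(2,3)[OF w t h that], of b]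
        unfolding cloud_process_def leaf_process_def one_event_path(1)[OF w t h that] by linarith
    qed
  qed measurable
  moreover have "expectation ?A = c * mean_cloud c (\<not> b) t"
    by (simp add: mean_cloud_def)
  moreover have "expectation ?J = hyp b 0 / 2 * mean_leaf c True t - mean_leaf c b t / 2"
    using leaf_process_integrable[OF c t] by (simp add: mean_leaf_def)
  ultimately show ?thesis
    by (simp only: cloud_drift_def mean_cloud_def mean_leaf_def K_def E_def)
qed

lemma abs_drift_le:
  assumes "0 \<le> c" "0 \<le> t" "t \<le> T"
  shows "\<bar>leaf_drift c b t\<bar> \<le> (c + 2 * rate) * exp (c * T)"
    and "\<bar>cloud_drift c b t\<bar> \<le> (c + 2 * rate) * exp (c * T)"
proof -
  let ?E = "exp (c * T)"
  note m = abs_mean_le[OF assms]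
  have half: "\<bar>hyp b 0 / 2 * mean_leaf c True t\<bar> \<le> ?E" "\<bar>mean_leaf c b t / 2\<bar> \<le> ?E"
    using m(1)[of True] m(1)[of b] by (auto simp: hyp_zero)
  have *: "\<bar>c * x + rate * y\<bar> \<le> (c + 2 * rate) * ?E" if "\<bar>x\<bar> \<le> ?E" "\<bar>y\<bar> \<le> 2 * ?E" for x y
  proof -
    have "\<bar>c * x + rate * y\<bar> \<le> c * ?E + rate * (2 * ?E)"
      using that assms(1) rate_pos
      by (intro order.trans[OF abs_triangle_ineq] add_mono) (auto simp: abs_mult mult_left_mono)
    then show ?thesis
      by (simp add: algebra_simps)
  qed
  show "\<bar>leaf_drift c b t\<bar> \<le> (c + 2 * rate) * ?E"
    unfolding leaf_drift_def using half m(1)[of b] by (intro * m) linarith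
  show "\<bar>cloud_drift c b t\<bar> \<le> (c + 2 * rate) * ?E"
    unfolding cloud_drift_def using half by (intro * m) linarith
qed

text \<open>Boundedness of the drifts suffices at this stage. Continuity of the means then makes the
  drifts, which are linear in them, continuous, and this allows differentiation.\<close>

lemma continuous_on_mean:
  assumes "0 \<le> c"
  shows "continuous_on {0..} (mean_leaf c b)" and "continuous_on {0..} (mean_cloud c b)"
proof -
  show "continuous_on {0..} (mean_leaf c b)"
    by (rule continuous_on_from_increments[of _ "leaf_drift c b"])
      (use mean_leaf_increment[OF assms] abs_drift_le(1)[OF assms] in blast)+
  show "continuous_on {0..} (mean_cloud c b)"
    by (rule continuous_on_from_increments[of _ "cloud_drift c b"])
      (use mean_cloud_increment[OF assms] abs_drift_le(2)[OF assms] in blast)+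
qed

lemma mean_has_derivative:
  assumes c: "0 \<le> c" and t: "0 \<le> t"
  shows "(mean_leaf c b has_real_derivative leaf_drift c b t) (at t within {0..})"
    and "(mean_cloud c b has_real_derivative cloud_drift c b t) (at t within {0..})"
proof -
  have "continuous_on {0..} (leaf_drift c b)" "continuous_on {0..} (cloud_drift c b)"
    unfolding leaf_drift_def cloud_drift_def
    by (auto intro!: continuous_intros continuous_on_mean c)
  note cont = this
  show "(mean_leaf c b has_real_derivative leaf_drift c b t) (at t within {0..})"
    by (rule has_derivative_from_increments[OF _ cont(1) t]) (use mean_leaf_increment[OF c] in blast)
  show "(mean_cloud c b has_real_derivative cloud_drift c b t) (at t within {0..})"
    by (rule has_derivative_from_increments[OF _ cont(2) t]) (use mean_cloud_increment[OF c] in blast)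
qed

section \<open>Initial values and explicit solution for the leaf\<close>

lemma mean_leaf_0: "mean_leaf c True 0 = 1" "mean_leaf c False 0 = 0"
proof -
  have "leaf_process b c N 0 \<omega> = hyp b 0" if "\<omega> \<in> space M" for b \<omega>
    using counting_zero[OF that] events_until_path[OF that, of 0]
    by (simp add: leaf_process_def leaf_def events_until_def)
  then have "mean_leaf c b 0 = expectation (\<lambda>_. hyp b 0)" for b
    unfolding mean_leaf_def by (intro Bochner_Integration.integral_cong) auto
  then show "mean_leaf c True 0 = 1" "mean_leaf c False 0 = 0"
    by (simp_all add: hyp_zero prob_space)
qed

text \<open>\<open>(c, r + rate / 2)\<close> is a left eigenvector, with eigenvalue \<open>r\<close>, of the linear system for the
  pair \<open>mean_leaf c True\<close>, \<open>mean_leaf c False\<close>.\<close>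

lemma mean_leaf_eigen:
  assumes c: "0 \<le> c" and t: "0 \<le> t" and r: "(r + rate) * (r + rate / 2) = c\<^sup>2"
  shows "c * mean_leaf c True t + (r + rate / 2) * mean_leaf c False t = c * exp (r * t)"
proof -
  let ?f = "\<lambda>t. c * mean_leaf c True t + (r + rate / 2) * mean_leaf c False t"
  have "(?f has_real_derivative r * ?f s) (at s within {0..})" if "0 \<le> s" for s
  proof -
    \<comment> \<open>The remaining coefficient is the negative of the characteristic polynomial of
      the system at \<open>r\<close>, hence zero.\<close>
    have "c * leaf_drift c True s + (r + rate / 2) * leaf_drift c False s =
        r * ?f s + (c\<^sup>2 - (r + rate) * (r + rate / 2)) * mean_leaf c False s"
      by (simp add: leaf_drift_def hyp_zero power2_eq_square field_simps)
    then have "c * leaf_drift c True s + (r + rate / 2) * leaf_drift c False s = r * ?f s"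
      using r by simp
    moreover have "(?f has_real_derivative c * leaf_drift c True s + (r + rate / 2) * leaf_drift c False s)
        (at s within {0..})"
      by (intro DERIV_add DERIV_cmult mean_has_derivative c that)
    ultimately show ?thesis
      by (simp only:)
  qed
  from exponential_solution[OF this t] show ?thesis
    by (simp add: mean_leaf_0)
qed

text \<open>The equation \<open>(r + rate) * (r + rate / 2) = c\<^sup>2\<close> has the roots
  \<open>- (3 / 4) * rate + s * d / 4\<close> with \<open>s\<close> equal to 1 or -1, so
  \<open>mean_leaf_eigen\<close> gives two equations for the two means.\<close>

lemma mean_leaf_False:
  assumes c: "0 < c" and t: "0 \<le> t"
  defines "d \<equiv> sqrt (rate\<^sup>2 + 16 * c\<^sup>2)"
  shows "mean_leaf c False t = 2 * c / d * exp (- (3 / 4) * rate * t) * (exp (t / 4 * d) - exp (- (t / 4) * d))"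
proof -
  have d: "d\<^sup>2 = rate\<^sup>2 + 16 * c\<^sup>2" "0 < d"
    using c by (auto simp: d_def add_nonneg_pos)
  let ?r = "\<lambda>s. - (3 / 4) * rate + s * d / 4"
  have r: "(?r s + rate) * (?r s + rate / 2) = c\<^sup>2" if "s\<^sup>2 = 1" for s
  proof -
    have "(?r s + rate) * (?r s + rate / 2) = (s\<^sup>2 * d\<^sup>2 - rate\<^sup>2) / 16"
      by (simp add: power2_eq_square field_simps)
    then show ?thesis
      using d that by simp
  qed
  have e: "exp (?r s * t) = exp (- (3 / 4) * rate * t) * exp (s * (t / 4) * d)" for s
    by (simp add: exp_add[symmetric] algebra_simps)
  have "c * mean_leaf c True t + (?r s + rate / 2) * mean_leaf c False t =
      c * (exp (- (3 / 4) * rate * t) * exp (s * (t / 4) * d))" if "s\<^sup>2 = 1" for s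
    using mean_leaf_eigen[OF less_imp_le[OF c] t r[OF that]] unfolding e .
  \<comment> \<open>Subtracting the two identities removes \<open>mean_leaf c True t\<close>; the
    factor \<open>d / 2\<close> is the difference of the eigenvalues.\<close>
  from this[of 1] this[of "- 1"]
  have "d / 2 * mean_leaf c False t = c * exp (- (3 / 4) * rate * t) * (exp (t / 4 * d) - exp (- (t / 4) * d))"
    by (simp add: algebra_simps)
  then show ?thesis
    using d(2) by (simp add: field_simps)
qed

end

text \<open>The integral and \<open>deriv\<close> are total functions, so integrability and
  differentiability are asserted along with the equation to give it its intended meaning.\<close>

theorem theorem5p1:
  fixes M :: "'a measure" and N :: "real \<Rightarrow> 'a \<Rightarrow> nat" and c lambda :: real
  defines "u \<equiv> (\<lambda>t::real. integral\<^sup>L M (\<lambda>\<omega>. cosh (eta_cm N c t \<omega>)))"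
  assumes "0 < c" and "0 < lambda"
    and "homogeneous_poisson_process M N lambda"
  shows "\<forall>t>0. integrable M (\<lambda>\<omega>. cosh (eta_cm N c t \<omega>)) \<and>
    u differentiable (at t) \<and> deriv u differentiable (at t) \<and>
    deriv (deriv u) t - c\<^sup>2 * u t =
      lambda * c\<^sup>2 * exp (- (3 / 4) * lambda * t) / sqrt (lambda\<^sup>2 + 16 * c\<^sup>2) *
        (exp (- (t / 4) * sqrt (lambda\<^sup>2 + 16 * c\<^sup>2)) - exp (t / 4 * sqrt (lambda\<^sup>2 + 16 * c\<^sup>2)))"
proof (intro allI impI)
  fix t :: real
  assume t: "0 < t"
  interpret homogeneous_poisson_process M N lambda
    by fact
  have c: "0 \<le> c"
    using \<open>0 < c\<close> by simp
  have u: "u = mean_cloud c True"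
    unfolding u_def mean_cloud_def cosh_eta_cm ..
  \<comment> \<open>A positive time is interior to \<open>{0..}\<close>, so the derivative within
    this set is the ordinary one.\<close>
  have deriv_at: "(mean_cloud c b has_real_derivative cloud_drift c b s) (at s)" if "0 < s" for b s
    using mean_has_derivative(2)[OF c, of s b] that at_within_interior[of s "{0..}"]
    by (simp add: interior_Ici[of "-1"])
  \<comment> \<open>The mean jump cancels for the \<open>cosh\<close> average; the
    \<open>sinh\<close> average loses half of the last particle's \<open>sinh\<close> part.\<close>
  have drift: "cloud_drift c True s = c * mean_cloud c False s"
    "cloud_drift c False s = c * u s - lambda / 2 * mean_leaf c False s" for s
    by (simp_all add: cloud_drift_def hyp_zero u)
  have deriv_u: "deriv u s = c * mean_cloud c False s" if "0 < s" for s
    using DERIV_imp_deriv[OF deriv_at[OF that, of True]] by (simp add: u drift)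
  have "((\<lambda>s. c * mean_cloud c False s) has_real_derivative c * cloud_drift c False t) (at t)"
    using deriv_at[OF t] by (rule DERIV_cmult)
  \<comment> \<open>The formula for \<open>deriv u\<close> is known at positive times only, so it is
    transferred on the open half-line.\<close>
  then have deriv2: "(deriv u has_real_derivative c * cloud_drift c False t) (at t)"
    by (rule has_field_derivative_transform_within_open[of _ _ _ "{0<..}"]) (use t in \<open>auto simp: deriv_u\<close>)
  have "deriv (deriv u) t - c\<^sup>2 * u t = - (lambda * c / 2 * mean_leaf c False t)"
    by (simp add: DERIV_imp_deriv[OF deriv2] drift power2_eq_square algebra_simps)
  also have "\<dots> = lambda * c\<^sup>2 * exp (- (3 / 4) * lambda * t) / sqrt (lambda\<^sup>2 + 16 * c\<^sup>2) *
        (exp (- (t / 4) * sqrt (lambda\<^sup>2 + 16 * c\<^sup>2)) - exp (t / 4 * sqrt (lambda\<^sup>2 + 16 * c\<^sup>2)))"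
    unfolding mean_leaf_False[OF \<open>0 < c\<close> less_imp_le[OF t]]
    by (simp add: power2_eq_square algebra_simps diff_divide_distrib)
  finally show "integrable M (\<lambda>\<omega>. cosh (eta_cm N c t \<omega>)) \<and>
    u differentiable (at t) \<and> deriv u differentiable (at t) \<and>
    deriv (deriv u) t - c\<^sup>2 * u t =
      lambda * c\<^sup>2 * exp (- (3 / 4) * lambda * t) / sqrt (lambda\<^sup>2 + 16 * c\<^sup>2) *
        (exp (- (t / 4) * sqrt (lambda\<^sup>2 + 16 * c\<^sup>2)) - exp (t / 4 * sqrt (lambda\<^sup>2 + 16 * c\<^sup>2)))"
    using cloud_process_integrable[OF c, of t True] deriv_at[OF t, of True] deriv2 t
    by (auto simp: cosh_eta_cm u real_differentiable_def)
qed

end
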